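(* Let $(K,v)$ be a field with valuation with value group $\Gamma$, let $w\in\Gamma^n$, let $\prec$ be a monomial order on $K[x_1,\ldots,x_n]$, and let $d\ge1$. Let $S=\{g_1,\ldots,g_s\}\subset K[x_1,\ldots,x_n]^d$ be a finite set of nonzero homogeneous elements and let $I$ be the submodule of $K[x_1,\ldots,x_n]^d$ generated by $S$. If the remainder of $\operatorname{S-form}(g_i,g_j)$ on division by $S$ is $0$ for all $g_i,g_j\in S$, then $S$ is a Gröbner basis for $I$ (with respect to $w$).
   Context: A field with valuation is a field $K$ with a function $v:K\to\mathbb{R}\cup\{\infty\}$ such that $v$ restricts to a group homomorphism $K^*\to(\mathbb{R},+)$, $v(a+b)\ge\min\{v(a),v(b)\}$, and $v(a)=\infty$ iff $a=0$. Its value group is $\Gamma=v(K^* )$; $R_K=\{c\in K:v(c)\ge0\}$ is a local ring with maximal ideal $J_K=\{c:v(c)>0\}$ and residue field $\Bbbk=R_K/J_K$; $\overline{a}$ denotes the image of $a\in R_K$ in $\Bbbk$. A group homomorphism $\Gamma\to K^*$, $\gamma\mapsto t^\gamma$, with $v(t^\gamma)=\gamma$ is fixed. Let $e_1,\ldots,e_d$ be the standard basis. Every element of $K[x_1,\ldots,x_n]^d$ is a finite sum $f=\sum c_{u,k}x^ue_k$; $c_{u,k}x^ue_k$ is called a term, $x^ue_k$ a monomial, of degree $|u|=u_1+\cdots+u_n$, and $\operatorname{supp}(f)=\{(u,k):c_{u,k}\ne0\}$. An element is homogeneous if all its monomials have the same degree. Monomials are ordered by: $x^\alpha e_i\prec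 x^\beta e_j$ if $x^\alpha\prec x^\beta$, or $x^\alpha=x^\beta$ and $e_i\prec e_j$, where $e_1\prec\cdots\prec e_d$. For $f\ne0$ put $W=\min_{(u,k)\in\operatorname{supp}(f)}\{v(c_{u,k})+w\cdot u\}$. The initial form is $$\operatorname{in}_w(f)=\sum_{(u,k)\in\operatorname{supp}(f),\ v(c_{u,k})+w\cdot u=W}\overline{c_{u,k}t^{-v(c_{u,k})}}\,x^ue_k\in\Bbbk[x_1,\ldots,x_n]^d,$$ with $\operatorname{in}_w(0)=0$. The term $\operatorname{in}_{w,\prec}(f)$ is the term $c_{u,k}x^ue_k$ of $f$ whose monomial is the $\prec$-largest monomial of $\operatorname{in}_w(f)$. For a submodule $I$, $\operatorname{in}_w(I)=\langle\operatorname{in}_w(f):f\in I\rangle\subseteq\Bbbk[x_1,\ldots,x_n]^d$. A finite generating set $G=\{g_1,\ldots,g_s\}$ of $I$ is a Gröbner basis of $I$ (with respect to $w$) iff $\operatorname{in}_w(I)=\langle\operatorname{in}_w(g_1),\ldots,\operatorname{in}_w(g_s)\rangle$. Nonzero terms are compared by: $ax^\alpha e_i<bx^\beta e_j$ if $v(a)+w\cdot\alpha<v(b)+w\cdot\beta$, or if these are equal and $x^\alpha e_i\succ x^\beta e_j$; $t\ge t'$ means that $t<t'$ does not hold. By convention $\operatorname{in}_{w,\prec}(0)=0$ is larger than every nonzero term and $0\ge0$. A nonzero term $bx^\beta e_j$ divides $ax^\alpha e_i$ if $i=j$ and $bx^\beta$ divides $ax^\alpha$. For terms, $\operatorname{LCM}(ax^\alpha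 e_i,bx^\beta e_j)=\operatorname{LCM}(x^\alpha,x^\beta)e_j$ if $i=j$, and $0$ otherwise. For nonzero $f,g$ with $m=\operatorname{LCM}(\operatorname{in}_{w,\prec}(f),\operatorname{in}_{w,\prec}(g))$, $$\operatorname{S-form}(f,g)=\frac{m}{\operatorname{in}_{w,\prec}(f)}f-\frac{m}{\operatorname{in}_{w,\prec}(g)}g,$$ where, for $m\neq0$, the quotient is the term of $K[x_1,\ldots,x_n]$ whose product with the denominator is $m$; if $m=0$ the S-form is $0$. A remainder of a homogeneous $f$ on division by $S$ is an $r\in K[x_1,\ldots,x_n]^d$ for which there are $h_1,\ldots,h_s\in K[x_1,\ldots,x_n]$ with $f=\sum_ih_ig_i+r$, $\operatorname{in}_{w,\prec}(r)\ge\operatorname{in}_{w,\prec}(f)$, $\operatorname{in}_{w,\prec}(h_ig_i)\ge\operatorname{in}_{w,\prec}(f)$ for all $i$, and no monomial of $r$ divisible by any $\operatorname{in}_{w,\prec}(g_i)$. "The remainder of $f$ on division by $S$ is $0$" means that $r=0$ is such a remainder, i.e. $f=\sum_ih_ig_i$ with $\operatorname{in}_{w,\prec}(h_ig_i)\ge\operatorname{in}_{w,\prec}(f)$ for all $i$. *)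

theory Defs
  imports "HOL-Analysis.Cartesian_Space" "HOL-Library.Poly_Mapping" "HOL-Library.Extended_Real"
begin

section \<open>Fields with valuation\<close>

class valued_field = field +
  fixes val :: "'a \<Rightarrow> ereal"
  assumes val_not_MInfty: "val a \<noteq> - \<infinity>"
    and val_eq_PInfty_iff: "val a = \<infinity> \<longleftrightarrow> a = 0"
    and val_mult: "a \<noteq> 0 \<Longrightarrow> b \<noteq> 0 \<Longrightarrow> val (a * b) = val a + val b"
    and val_add: "min (val a) (val b) \<le> val (a + b)"

definition value_group :: "'k::valued_field itself \<Rightarrow> real set" where
  "value_group _ = {\<gamma>. \<exists>a::'k. a \<noteq> 0 \<and> val a = ereal \<gamma>}"

text \<open>The homomorphism \<open>\<gamma> \<mapsto> t\<^sup>\<gamma>\<close> is a function on the reals; only its values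
  on the value group matter.\<close>

definition splitting :: "(real \<Rightarrow> 'k::valued_field) \<Rightarrow> bool" where
  "splitting t \<longleftrightarrow>
     (\<forall>\<gamma>\<in>value_group TYPE('k). t \<gamma> \<noteq> 0 \<and> val (t \<gamma>) = ereal \<gamma>) \<and>
     (\<forall>\<gamma>\<in>value_group TYPE('k). \<forall>\<delta>\<in>value_group TYPE('k). t (\<gamma> + \<delta>) = t \<gamma> * t \<delta>)"

lemma val_zero [simp]: "val (0::'k::valued_field) = \<infinity>"
  by (simp add: val_eq_PInfty_iff)

lemma val_finite:
  assumes "a \<noteq> (0::'k::valued_field)" obtains r where "val a = ereal r"
  using assms val_not_MInfty[of a] val_eq_PInfty_iff[of a] by (cases "val a") auto

lemma val_mult': "val (a * b) = val a + val (b::'k::valued_field)"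
  using val_mult[of a b] val_not_MInfty[of a] val_not_MInfty[of b]
  by (cases "a = 0"; cases "b = 0") auto

lemma val_one [simp]: "val (1::'k::valued_field) = 0"
proof -
  obtain r where r: "val (1::'k) = ereal r" using val_finite[of "1::'k"] by auto
  then show ?thesis using val_mult'[of 1 "1::'k"] by (simp add: zero_ereal_def)
qed

lemma val_minus [simp]: "val (- a) = val (a::'k::valued_field)"
proof -
  obtain r where r: "val (- 1::'k) = ereal r" using val_finite[of "- 1::'k"] by auto
  then have "r = 0" using val_mult'[of "- 1" "- 1::'k"] by (simp add: zero_ereal_def)
  then show ?thesis using val_mult'[of "- 1" a] r by simp
qed

lemma val_eq_0_imp_nonzero: "val a = 0 \<Longrightarrow> (a::'k::valued_field) \<noteq> 0"
  by auto

lemma val_inverse: "val a = 0 \<Longrightarrow> val (inverse (a::'k::valued_field)) = 0"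
  using val_mult'[of a "inverse a"] val_eq_0_imp_nonzero[of a] by simp

lemma val_add_nonneg: "0 \<le> val a \<Longrightarrow> 0 \<le> val b \<Longrightarrow> 0 \<le> val (a + b :: 'k::valued_field)"
  using val_add[of a b] by (auto simp: min_def split: if_splits)

lemma val_diff_nonneg: "0 \<le> val a \<Longrightarrow> 0 \<le> val b \<Longrightarrow> 0 \<le> val (a - b :: 'k::valued_field)"
  using val_add_nonneg[of a "- b"] by simp

lemma val_add_pos: "0 < val a \<Longrightarrow> 0 < val b \<Longrightarrow> 0 < val (a + b :: 'k::valued_field)"
  using val_add[of a b] by (auto simp: min_def split: if_splits)

lemma val_mult_nonneg: "0 \<le> val a \<Longrightarrow> 0 \<le> val b \<Longrightarrow> 0 \<le> val (a * b :: 'k::valued_field)"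
  by (simp add: val_mult')

lemma val_mult_pos: "0 < val a \<Longrightarrow> 0 \<le> val b \<Longrightarrow> 0 < val (a * b :: 'k::valued_field)"
  by (simp add: val_mult' add_pos_nonneg)

lemma val_eq_0_cong:
  fixes a b :: "'k::valued_field"
  assumes "0 < val (a - b)" "val a = 0" "0 \<le> val b"
  shows "val b = 0"
proof (rule ccontr)
  assume "val b \<noteq> 0"
  then have "0 < val b" using assms by simp
  then have "0 < val (a - b + b)" using assms val_add_pos by blast
  then show False using assms by simp
qed


section \<open>The residue field\<close>

text \<open>Two elements of the valuation ring are identified iff their difference lies in the
  maximal ideal, so the quotient is \<open>R\<^sub>K / J\<^sub>K\<close>. The map \<open>residue\<close> produced by the quotient is
  the reduction map; it is meaningful on elements of nonnegative valuation only.\<close>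

definition residue_rel :: "'k::valued_field \<Rightarrow> 'k \<Rightarrow> bool" where
  "residue_rel a b \<longleftrightarrow> 0 \<le> val a \<and> 0 \<le> val b \<and> 0 < val (a - b)"

lemma part_equivp_residue_rel: "part_equivp residue_rel"
proof (rule part_equivpI)
  show "\<exists>x. residue_rel x x" by (rule exI[of _ 0]) (simp add: residue_rel_def)
  show "symp residue_rel"
    unfolding symp_def residue_rel_def by (metis minus_diff_eq val_minus)
  show "transp residue_rel"
    unfolding transp_def residue_rel_def by (metis diff_add_cancel add_diff_eq val_add_pos)
qed

quotient_type (overloaded) 'k residue_field = "'k::valued_field" / partial: residue_rel
  morphisms rep_residue residue
  by (rule part_equivp_residue_rel)

instantiation residue_field :: (valued_field) field
begin

lift_definition zero_residue_field :: "'a residue_field" is 0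
  by (simp add: residue_rel_def)

lift_definition one_residue_field :: "'a residue_field" is 1
  by (simp add: residue_rel_def)

lift_definition plus_residue_field :: "'a residue_field \<Rightarrow> 'a residue_field \<Rightarrow> 'a residue_field"
  is "(+)"
  unfolding residue_rel_def by (metis add_diff_add val_add_nonneg val_add_pos)

lift_definition uminus_residue_field :: "'a residue_field \<Rightarrow> 'a residue_field" is uminus
  unfolding residue_rel_def by (metis minus_diff_minus val_minus)

lift_definition minus_residue_field :: "'a residue_field \<Rightarrow> 'a residue_field \<Rightarrow> 'a residue_field"
  is "(-)"
proof -
  fix a b c d :: 'a
  assume "residue_rel a b" "residue_rel c d"
  moreover have "a - c - (b - d) = (a - b) + (- (c - d))" by simp
  ultimately show "residue_rel (a - c) (b - d)"
    unfolding residue_rel_def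
    by (metis diff_conv_add_uminus val_add_nonneg val_add_pos val_minus)
qed

lift_definition times_residue_field :: "'a residue_field \<Rightarrow> 'a residue_field \<Rightarrow> 'a residue_field"
  is "(*)"
proof -
  fix a b c d :: 'a
  assume *: "residue_rel a b" "residue_rel c d"
  have "a * c - b * d = (a - b) * c + (c - d) * b" by (simp add: algebra_simps)
  with * show "residue_rel (a * c) (b * d)"
    unfolding residue_rel_def by (metis val_add_pos val_mult_nonneg val_mult_pos)
qed

lift_definition inverse_residue_field :: "'a residue_field \<Rightarrow> 'a residue_field"
  is "\<lambda>a. if val a = 0 then inverse a else 0"
proof -
  fix a b :: 'a
  assume *: "residue_rel a b"
  then have **: "0 < val (a - b)" "0 < val (b - a)" "0 \<le> val a" "0 \<le> val b"
    unfolding residue_rel_def by (metis minus_diff_eq val_minus)+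
  then have iff: "val a = 0 \<longleftrightarrow> val b = 0" using val_eq_0_cong by blast
  show "residue_rel (if val a = 0 then inverse a else 0) (if val b = 0 then inverse b else 0)"
  proof (cases "val a = 0")
    case True
    with iff have b: "val b = 0" by simp
    with True have nz: "a \<noteq> 0" "b \<noteq> 0" by auto
    have inv: "val (inverse a) = 0" "val (inverse b) = 0" using True b nz val_inverse by auto
    have "inverse a - inverse b = (b - a) * (inverse a * inverse b)"
      using nz by (simp add: field_simps)
    then have "val (inverse a - inverse b) = val (b - a)" using inv by (simp add: val_mult')
    with inv True b ** show ?thesis by (simp add: residue_rel_def)
  next
    case False
    with iff show ?thesis by (simp add: residue_rel_def)
  qed
qed

definition divide_residue_field :: "'a residue_field \<Rightarrow> 'a residue_field \<Rightarrow> 'a residue_field" where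
  "divide_residue_field a b = a * inverse b"

instance
proof
  fix a b c :: "'a residue_field"
  show "a * b * c = a * (b * c)"
    by transfer (simp add: residue_rel_def mult.assoc val_mult')
  show "a * b = b * a"
    by transfer (simp add: residue_rel_def mult.commute val_mult')
  show "1 * a = a"
    by transfer (simp add: residue_rel_def)
  show "a + b + c = a + (b + c)"
    by transfer (simp add: residue_rel_def add.assoc val_add_nonneg)
  show "a + b = b + a"
    by transfer (simp add: residue_rel_def add.commute val_add_nonneg)
  show "0 + a = a"
    by transfer (simp add: residue_rel_def)
  show "- a + a = 0"
    by transfer (simp add: residue_rel_def)
  show "a - b = a + - b"
    by transfer (simp add: residue_rel_def val_diff_nonneg)
  show "(a + b) * c = a * c + b * c"
    by transfer (simp add: residue_rel_def distrib_right val_add_nonneg val_mult_nonneg)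
  show "(0::'a residue_field) \<noteq> 1"
    by transfer (simp add: residue_rel_def)
  show "a \<noteq> 0 \<Longrightarrow> inverse a * a = 1"
    by transfer (auto simp: residue_rel_def val_inverse val_eq_0_imp_nonzero)
  show "a div b = a * inverse b"
    by (simp add: divide_residue_field_def)
  show "inverse (0::'a residue_field) = 0"
    by transfer (simp add: residue_rel_def)
qed

end

lemma residue_eq_iff:
  "0 \<le> val a \<Longrightarrow> 0 \<le> val b \<Longrightarrow> residue a = residue b \<longleftrightarrow> 0 < val (a - b)"
  using Quotient_rel[OF Quotient_residue_field, of a b] Quotient_rel_abs
  by (auto simp: residue_rel_def)


section \<open>Polynomials and free modules\<close>

text \<open>\<open>K[x\<^sub>1,\<dots>,x\<^sub>n]\<close> is the monoid algebra of the exponent vectors \<open>nat^'n\<close>, with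
  \<open>n = CARD('n)\<close>. Its free module of rank \<open>d = CARD('d)\<close> is the type of vectors over it, and
  \<open>e\<^sub>1 \<prec> \<dots> \<prec> e\<^sub>d\<close> is the linear order of the index type \<open>'d\<close>.\<close>

type_synonym ('k, 'n) mpoly = "(nat ^ 'n) \<Rightarrow>\<^sub>0 'k"
type_synonym ('k, 'n, 'd) free_mod = "((nat ^ 'n) \<Rightarrow>\<^sub>0 'k) ^ 'd"

lemma module_vec: "module ((*s) :: 'a::comm_ring_1 \<Rightarrow> 'a ^ 'd \<Rightarrow> 'a ^ 'd)"
  by unfold_locales (simp_all add: vec_eq_iff algebra_simps)

abbreviation submod_span :: "('a::comm_ring_1 ^ 'd) set \<Rightarrow> ('a ^ 'd) set" where
  "submod_span \<equiv> module.span (*s)"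

definition mterm :: "'k::zero \<Rightarrow> nat ^ 'n \<Rightarrow> 'd::finite \<Rightarrow> ('k, 'n, 'd) free_mod" where
  "mterm c u k = axis k (Poly_Mapping.single u c)"

definition mcoeff :: "('k::zero, 'n::finite, 'd::finite) free_mod \<Rightarrow> (nat ^ 'n) \<times> 'd \<Rightarrow> 'k" where
  "mcoeff f = (\<lambda>(u, k). Poly_Mapping.lookup (f $ k) u)"

definition msupp :: "('k::zero, 'n::finite, 'd::finite) free_mod \<Rightarrow> ((nat ^ 'n) \<times> 'd) set" where
  "msupp f = {m. mcoeff f m \<noteq> 0}"

definition mdeg :: "nat ^ 'n \<Rightarrow> nat" where
  "mdeg u = (\<Sum>i\<in>UNIV. u $ i)"

definition homogeneous :: "('k::zero, 'n::finite, 'd::finite) free_mod \<Rightarrow> bool" where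
  "homogeneous f \<longleftrightarrow> (\<exists>D. \<forall>(u, k)\<in>msupp f. mdeg u = D)"

definition monomial_order :: "(nat ^ 'n \<Rightarrow> nat ^ 'n \<Rightarrow> bool) \<Rightarrow> bool" where
  "monomial_order prec \<longleftrightarrow>
     irreflp prec \<and> transp prec \<and> totalp prec \<and>
     (\<forall>u v a. prec u v \<longrightarrow> prec (u + a) (v + a)) \<and>
     (\<forall>u. u \<noteq> 0 \<longrightarrow> prec 0 u)"

definition mon_less ::
  "(nat ^ 'n \<Rightarrow> nat ^ 'n \<Rightarrow> bool) \<Rightarrow> (nat ^ 'n) \<times> 'd::linorder \<Rightarrow> (nat ^ 'n) \<times> 'd \<Rightarrow> bool" where
  "mon_less prec = (\<lambda>(\<alpha>, i) (\<beta>, j). prec \<alpha> \<beta> \<or> \<alpha> = \<beta> \<and> i < j)"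


section \<open>Initial forms and Groebner bases\<close>

definition wdot :: "real ^ 'n \<Rightarrow> nat ^ 'n \<Rightarrow> real" where
  "wdot w u = (\<Sum>i\<in>UNIV. w $ i * real (u $ i))"

definition min_weight :: "real ^ 'n \<Rightarrow> ('k::valued_field, 'n::finite, 'd::finite) free_mod \<Rightarrow> ereal" where
  "min_weight w f = Min ((\<lambda>(u, k). val (mcoeff f (u, k)) + ereal (wdot w u)) ` msupp f)"

text \<open>For \<open>f = 0\<close> the sum is empty, so the initial form of \<open>0\<close> is \<open>0\<close>.\<close>

definition init_form ::
  "(real \<Rightarrow> 'k::valued_field) \<Rightarrow> real ^ 'n \<Rightarrow> ('k, 'n::finite, 'd::finite) free_mod \<Rightarrow>
   ('k residue_field, 'n, 'd) free_mod" where
  "init_form t w f =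
     (\<Sum>(u, k)\<in>{(u, k)\<in>msupp f. val (mcoeff f (u, k)) + ereal (wdot w u) = min_weight w f}.
        mterm (residue (mcoeff f (u, k) * t (- real_of_ereal (val (mcoeff f (u, k)))))) u k)"

definition init_submod ::
  "(real \<Rightarrow> 'k::valued_field) \<Rightarrow> real ^ 'n \<Rightarrow> ('k, 'n::finite, 'd::finite) free_mod set \<Rightarrow>
   ('k residue_field, 'n, 'd) free_mod set" where
  "init_submod t w I = submod_span (init_form t w ` I)"

definition groebner_basis ::
  "(real \<Rightarrow> 'k::valued_field) \<Rightarrow> real ^ 'n \<Rightarrow> ('k, 'n::finite, 'd::finite) free_mod set \<Rightarrow>
   ('k, 'n, 'd) free_mod set \<Rightarrow> bool" where
  "groebner_basis t w I G \<longleftrightarrow>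
     finite G \<and> submod_span G = I \<and> init_submod t w I = submod_span (init_form t w ` G)"


section \<open>Initial terms, S-forms and remainders\<close>

text \<open>Terms, including the zero term, are represented as elements of the free module.\<close>

definition init_term ::
  "(real \<Rightarrow> 'k::valued_field) \<Rightarrow> real ^ 'n \<Rightarrow> (nat ^ 'n \<Rightarrow> nat ^ 'n \<Rightarrow> bool) \<Rightarrow>
   ('k, 'n, 'd::{finite,linorder}) free_mod \<Rightarrow> ('k, 'n, 'd) free_mod" where
  "init_term t w prec f =
     (if f = 0 then 0
      else THE p. \<exists>u k. (u, k) \<in> msupp (init_form t w f) \<and>
             (\<forall>m\<in>msupp (init_form t w f). m \<noteq> (u, k) \<longrightarrow> mon_less prec m (u, k)) \<and>
             p = mterm (mcoeff f (u, k)) u k)"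

text \<open>The strict order on terms, with \<open>0\<close> above every nonzero term.\<close>

definition term_less ::
  "real ^ 'n \<Rightarrow> (nat ^ 'n \<Rightarrow> nat ^ 'n \<Rightarrow> bool) \<Rightarrow>
   ('k::valued_field, 'n, 'd::{finite,linorder}) free_mod \<Rightarrow> ('k, 'n, 'd) free_mod \<Rightarrow> bool" where
  "term_less w prec p q \<longleftrightarrow>
     (\<exists>a \<alpha> i. a \<noteq> 0 \<and> p = mterm a \<alpha> i \<and>
        (q = 0 \<or>
         (\<exists>b \<beta> j. b \<noteq> 0 \<and> q = mterm b \<beta> j \<and>
            (val a + ereal (wdot w \<alpha>) < val b + ereal (wdot w \<beta>) \<or>
             val a + ereal (wdot w \<alpha>) = val b + ereal (wdot w \<beta>) \<and>
             mon_less prec (\<beta>, j) (\<alpha>, i)))))"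

abbreviation term_ge ::
  "real ^ 'n \<Rightarrow> (nat ^ 'n \<Rightarrow> nat ^ 'n \<Rightarrow> bool) \<Rightarrow>
   ('k::valued_field, 'n, 'd::{finite,linorder}) free_mod \<Rightarrow> ('k, 'n, 'd) free_mod \<Rightarrow> bool" where
  "term_ge w prec p q \<equiv> \<not> term_less w prec p q"

definition term_dvd ::
  "('k::comm_ring_1, 'n::finite, 'd::finite) free_mod \<Rightarrow> ('k, 'n, 'd) free_mod \<Rightarrow> bool" where
  "term_dvd p q \<longleftrightarrow>
     (\<exists>b \<beta> j a \<alpha> i. b \<noteq> 0 \<and> p = mterm b \<beta> j \<and> q = mterm a \<alpha> i \<and> i = j \<and>
        Poly_Mapping.single \<beta> b dvd Poly_Mapping.single \<alpha> a)"

text \<open>Used for nonzero terms only, whose support is a singleton.\<close>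

definition term_lcm ::
  "('k::comm_ring_1, 'n::finite, 'd::finite) free_mod \<Rightarrow> ('k, 'n, 'd) free_mod \<Rightarrow> ('k, 'n, 'd) free_mod" where
  "term_lcm p q =
     (let (\<alpha>, i) = the_elem (msupp p); (\<beta>, j) = the_elem (msupp q)
      in if i = j then mterm 1 (\<chi> l. max (\<alpha> $ l) (\<beta> $ l)) j else 0)"

definition term_quot ::
  "('k::comm_ring_1, 'n::finite, 'd::finite) free_mod \<Rightarrow> ('k, 'n, 'd) free_mod \<Rightarrow> ('k, 'n) mpoly" where
  "term_quot m p = (THE q. (\<exists>c u. q = Poly_Mapping.single u c) \<and> q *s p = m)"

definition S_form ::
  "(real \<Rightarrow> 'k::valued_field) \<Rightarrow> real ^ 'n \<Rightarrow> (nat ^ 'n \<Rightarrow> nat ^ 'n \<Rightarrow> bool) \<Rightarrow>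
   ('k, 'n, 'd::{finite,linorder}) free_mod \<Rightarrow> ('k, 'n, 'd) free_mod \<Rightarrow> ('k, 'n, 'd) free_mod" where
  "S_form t w prec f g =
     (let p = init_term t w prec f; q = init_term t w prec g; m = term_lcm p q
      in if m = 0 then 0 else term_quot m p *s f - term_quot m q *s g)"

definition is_remainder ::
  "(real \<Rightarrow> 'k::valued_field) \<Rightarrow> real ^ 'n \<Rightarrow> (nat ^ 'n \<Rightarrow> nat ^ 'n \<Rightarrow> bool) \<Rightarrow>
   ('k, 'n, 'd::{finite,linorder}) free_mod set \<Rightarrow> ('k, 'n, 'd) free_mod \<Rightarrow>
   ('k, 'n, 'd) free_mod \<Rightarrow> bool" where
  "is_remainder t w prec S f r \<longleftrightarrow>
     (\<exists>h. f = (\<Sum>g\<in>S. h g *s g) + r \<and>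
        term_ge w prec (init_term t w prec r) (init_term t w prec f) \<and>
        (\<forall>g\<in>S. term_ge w prec (init_term t w prec (h g *s g)) (init_term t w prec f)) \<and>
        (\<forall>(u, k)\<in>msupp r. \<forall>g\<in>S. \<not> term_dvd (init_term t w prec g) (mterm 1 u k)))"

end

theory Submission
  imports Defs
begin

text \<open>
  Over a field with trivial valuation the criterion is proved by rewriting a representation
  \<open>f = \<Sum>\<^sub>i h\<^sub>i g\<^sub>i\<close> until its initial terms stop cancelling, and this ends because a monomial order is a
  well-order. Here the terms are compared by their weights first, and the weights range over a
  subgroup of the reals that may be dense, so such a rewriting need not end. Homogeneity
  replaces termination by linear algebra in finite dimension.

  Fix a degree bound \<open>D\<close> and consider the finitely many products \<open>x\<^sup>b g\<close> of degree at most \<open>D\<close>, with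
  \<open>g \<in> S\<close>, each scaled so that its initial term has weight \<open>0\<close>. For every monomial that leads one of
  these products choose one product with that leading monomial. If \<open>p\<close> is any product and \<open>q\<close> is the
  chosen one with the same leading monomial, then \<open>p - q\<close> is a term times an S-form. The
  hypothesis on S-forms writes \<open>p - q\<close> as a combination of the products whose coefficients have
  nonnegative valuation, and positive valuation except at products with a smaller leading
  monomial (\<open>multiple_diff_representation\<close>, \<open>all_after_smultD\<close>, \<open>truncated_representation\<close>). The
  coefficient matrix is therefore strictly triangular modulo the maximal ideal of the valuation
  ring, so \<open>1\<close> minus this matrix can be inverted, and every product is a linear combination of the
  chosen ones (\<open>unipotent_system_solution_in_subspace\<close>, \<open>multiples_in_span_of_representatives\<close>).

  If \<open>D\<close> is large enough, a given \<open>f\<close> in the submodule is then a linear combination of products with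
  pairwise distinct leading monomials. Among the summands of smallest weight the one with the
  largest leading monomial cannot be cancelled (\<open>lead_sum\<close>), so the weight of \<open>f\<close> is this
  smallest weight, and the initial form of \<open>f\<close> is the sum of the initial forms of these summands
  (\<open>init_form_sum\<close>). Each of them is a multiple of the initial form of an element of \<open>S\<close>.
\<close>
section \<open>The valuation on nonzero elements\<close>

text \<open>Away from \<open>0\<close> valuations are real numbers, which spares the arithmetic of infinite values; at
  \<open>0\<close> the value is junk.\<close>
definition rval :: "'k::valued_field \<Rightarrow> real" where
  "rval a = real_of_ereal (val a)"

lemma val_eq_rval: "a \<noteq> 0 \<Longrightarrow> val a = ereal (rval a)"
  unfolding rval_def by (rule val_finite[of a]) auto

lemma rval_mult: "a \<noteq> 0 \<Longrightarrow> b \<noteq> 0 \<Longrightarrow> rval (a * b) = rval a + rval b"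
  using val_mult[of a b] val_eq_rval[of a] val_eq_rval[of b] val_eq_rval[of "a * b"] by simp

lemma rval_one [simp]: "rval (1::'k::valued_field) = 0"
  by (simp add: rval_def)

lemma rval_minus [simp]: "rval (- a) = rval a"
  by (simp add: rval_def)

lemma rval_inverse: "a \<noteq> 0 \<Longrightarrow> rval (inverse a) = - rval a"
  using rval_mult[of a "inverse a"] by simp

lemma rval_divide: "a \<noteq> 0 \<Longrightarrow> b \<noteq> 0 \<Longrightarrow> rval (a / b) = rval a - rval b"
  by (simp add: divide_inverse rval_mult rval_inverse)

text \<open>Were the valuation of the sum larger than that of \<open>a\<close>, then writing \<open>a\<close> as the sum minus \<open>b\<close>
  would give \<open>a\<close> too large a valuation.\<close>
lemma rval_add_dominant:
  fixes a b :: "'k::valued_field"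
  assumes a: "a \<noteq> 0" and b: "b \<noteq> 0 \<Longrightarrow> rval a < rval b"
  shows "a + b \<noteq> 0 \<and> rval (a + b) = rval a"
proof (cases "b = 0")
  case True
  then show ?thesis using a by simp
next
  case False
  with b have lt: "rval a < rval b" by simp
  have va: "val a = ereal (rval a)" and vb: "val b = ereal (rval b)"
    using val_eq_rval a False by auto
  have le: "val a \<le> val (a + b)" using val_add[of a b] va vb lt by simp
  have "min (val (a + b)) (val b) \<le> val a" using val_add[of "a + b" "- b"] by simp
  then have "val (a + b) \<le> val a" using va vb lt by (auto simp: min_def split: if_splits)
  with le have "val (a + b) = val a" by simp
  then show ?thesis
    using a val_eq_PInfty_iff[of a] val_eq_PInfty_iff[of "a + b"] by (simp add: rval_def)
qed

lemma rval_sum_ge_summand: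
  fixes f :: "'a \<Rightarrow> 'k::valued_field"
  assumes "finite A" "sum f A \<noteq> 0"
  shows "\<exists>a\<in>A. f a \<noteq> 0 \<and> rval (f a) \<le> rval (sum f A)"
  using assms
proof (induction A rule: finite_induct)
  case (insert x F)
  show ?case
  proof (cases "sum f F \<noteq> 0 \<and> rval (sum f F) \<le> rval (sum f (insert x F))")
    case True
    with insert show ?thesis by (meson insertI2 order_trans)
  next
    case False
    have eq: "f x = sum f (insert x F) + - sum f F" using insert by simp
    have "f x \<noteq> 0 \<and> rval (f x) = rval (sum f (insert x F))"
      unfolding eq by (rule rval_add_dominant) (use False insert in auto)
    then show ?thesis by auto
  qed
qed simp

lemma rval_add_ge:
  fixes a b :: "'k::valued_field"
  assumes "a + b \<noteq> 0"
  shows "(a \<noteq> 0 \<and> rval a \<le> rval (a + b)) \<or> (b \<noteq> 0 \<and> rval b \<le> rval (a + b))"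
proof -
  have UB: "sum (\<lambda>x. if x then a else b) {True, False} = a + b" by simp
  show ?thesis
    using rval_sum_ge_summand[of "{True, False}" "\<lambda>x. if x then a else b"] assms
    unfolding UB by auto
qed

lemma val_nonneg_iff: "0 \<le> val a \<longleftrightarrow> a = 0 \<or> 0 \<le> rval a"
  by (cases "a = 0") (auto simp: val_eq_rval)

lemma val_pos_iff: "0 < val a \<longleftrightarrow> a = 0 \<or> 0 < rval a"
  by (cases "a = 0") (auto simp: val_eq_rval)

lemma residue_add:
  assumes "0 \<le> val a" "0 \<le> val b"
  shows "residue (a + b) = residue a + residue b"
  using plus_residue_field.abs_eq[of a b] assms by (simp add: residue_rel_def)

lemma residue_mult:
  assumes "0 \<le> val a" "0 \<le> val b"
  shows "residue (a * b) = residue a * residue b"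
  using times_residue_field.abs_eq[of a b] assms by (simp add: residue_rel_def)

lemma residue_0 [simp]: "residue 0 = 0"
  by (simp add: zero_residue_field_def)

lemma residue_eq_0_iff: "0 \<le> val a \<Longrightarrow> residue a = 0 \<longleftrightarrow> 0 < val a"
  using residue_eq_iff[of a 0] by simp

lemma residue_sum:
  assumes "\<And>a. a \<in> A \<Longrightarrow> 0 \<le> val (f a)"
  shows "0 \<le> val (sum f A) \<and> residue (sum f A) = (\<Sum>a\<in>A. residue (f a))"
  using assms
  by (induction A rule: infinite_finite_induct) (auto simp: residue_add val_add_nonneg)


section \<open>Linear systems that are unipotent modulo the maximal ideal\<close>

text \<open>Gaussian elimination. A maximal unknown \<open>z\<close> for \<open>R\<close> has all its coefficients in the maximal ideal, so
  \<open>1 - C z z\<close> is a unit and \<open>p z\<close> can be eliminated. The substitution changes \<open>C \<alpha> \<beta>\<close> by a multiple of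
  \<open>C \<alpha> z\<close>, hence by an element of the maximal ideal, and so the remaining smaller system satisfies
  the same hypotheses.\<close>
lemma unipotent_system_solution_in_subspace:
  fixes scale :: "'k::valued_field \<Rightarrow> 'v::ab_group_add \<Rightarrow> 'v"
    and p b :: "'a \<Rightarrow> 'v" and C :: "'a \<Rightarrow> 'a \<Rightarrow> 'k"
    and R :: "'a \<Rightarrow> 'a \<Rightarrow> bool"
  assumes vs: "vector_space scale" and N: "module.subspace scale N"
    and R: "irreflp R" "transp R"
    and "finite A"
    and "\<And>\<alpha>. \<alpha> \<in> A \<Longrightarrow> p \<alpha> = b \<alpha> + (\<Sum>\<beta>\<in>A. scale (C \<alpha> \<beta>) (p \<beta>))"
    and "\<And>\<alpha>. \<alpha> \<in> A \<Longrightarrow> b \<alpha> \<in> N"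
    and "\<And>\<alpha> \<beta>. \<alpha> \<in> A \<Longrightarrow> \<beta> \<in> A \<Longrightarrow> 0 \<le> val (C \<alpha> \<beta>)"
    and "\<And>\<alpha> \<beta>. \<alpha> \<in> A \<Longrightarrow> \<beta> \<in> A \<Longrightarrow> \<not> R \<beta> \<alpha> \<Longrightarrow> 0 < val (C \<alpha> \<beta>)"
  shows "\<alpha> \<in> A \<Longrightarrow> p \<alpha> \<in> N"
  using assms(5-)
proof (induction "card A" arbitrary: A b C \<alpha>)
  case 0
  then show ?case by simp
next
  case (Suc n)
  interpret V: vector_space scale by (rule vs)
  note fin = \<open>finite A\<close> and sys = Suc.prems(3) and bN = Suc.prems(4)
    and Cnn = Suc.prems(5) and Cpos = Suc.prems(6)
  have "A \<noteq> {}" using Suc.prems(1) by auto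
  have "asymp_on A R" "transp_on A R"
    using R by (auto intro!: asymp_onI transp_onI dest: transpD irreflpD)
  with fin \<open>A \<noteq> {}\<close> obtain z where z: "z \<in> A" "\<forall>x\<in>A. x \<noteq> z \<longrightarrow> \<not> R z x"
    using Finite_Set.bex_max_element[of A R] by metis
  then have max: "\<not> R z x" if "x \<in> A" for x using that R(1) by (metis irreflpD)
  define A' where "A' = A - {z}"
  have A: "A = insert z A'" "z \<notin> A'" "finite A'" using z fin by (auto simp: A'_def)
  define e where "e = 1 - C z z"
  have Czz: "0 < val (C z z)" using Cpos z max by simp
  have "e = 1 + - C z z" by (simp add: e_def)
  then have e: "e \<noteq> 0" "rval e = 0"
    using rval_add_dominant[of 1 "- C z z"] Czz by (auto simp: val_pos_iff)
  define q where "q = inverse e"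
  have q: "q \<noteq> 0" "0 \<le> val q" "q * e = 1"
    using e by (auto simp: q_def rval_inverse val_nonneg_iff)
  define b' where "b' \<alpha> = b \<alpha> + scale (C \<alpha> z * q) (b z)" for \<alpha>
  define C' where "C' \<alpha> \<beta> = C \<alpha> \<beta> + C \<alpha> z * q * C z \<beta>" for \<alpha> \<beta>
  have pz: "p z = scale q (b z) + (\<Sum>\<beta>\<in>A'. scale (q * C z \<beta>) (p \<beta>))"
  proof -
    have "p z = b z + (\<Sum>\<beta>\<in>A. scale (C z \<beta>) (p \<beta>))" by (rule sys[OF z(1)])
    also have "\<dots> = b z + (\<Sum>\<beta>\<in>A'. scale (C z \<beta>) (p \<beta>)) + scale (C z z) (p z)"
      using A by (simp add: add_ac)
    finally have "p z - scale (C z z) (p z) = b z + (\<Sum>\<beta>\<in>A'. scale (C z \<beta>) (p \<beta>))"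
      by (simp only: diff_eq_eq)
    then have "scale e (p z) = b z + (\<Sum>\<beta>\<in>A'. scale (C z \<beta>) (p \<beta>))"
      by (simp add: e_def V.scale_left_diff_distrib)
    then have "scale q (scale e (p z)) = scale q (b z + (\<Sum>\<beta>\<in>A'. scale (C z \<beta>) (p \<beta>)))"
      by (rule arg_cong)
    moreover have "scale q (scale e (p z)) = p z" using q(3) by simp
    ultimately show ?thesis by (simp add: V.scale_right_distrib V.scale_sum_right)
  qed
  have p': "p \<alpha> = b' \<alpha> + (\<Sum>\<beta>\<in>A'. scale (C' \<alpha> \<beta>) (p \<beta>))" if "\<alpha> \<in> A'" for \<alpha>
  proof -
    have "p \<alpha> = b \<alpha> + scale (C \<alpha> z) (p z) + (\<Sum>\<beta>\<in>A'. scale (C \<alpha> \<beta>) (p \<beta>))"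
      by (subst sys) (use that A in \<open>simp_all add: add_ac\<close>)
    also have "scale (C \<alpha> z) (p z) =
        scale (C \<alpha> z * q) (b z) + (\<Sum>\<beta>\<in>A'. scale (C \<alpha> z * q * C z \<beta>) (p \<beta>))"
      by (subst pz) (simp add: V.scale_right_distrib V.scale_sum_right mult.assoc)
    finally show ?thesis
      by (simp add: b'_def C'_def V.scale_left_distrib sum.distrib algebra_simps)
  qed
  have rest: "p \<beta> \<in> N" if "\<beta> \<in> A'" for \<beta>
  proof (rule Suc.hyps(1)[of A' \<beta> b' C'])
    show "n = card A'" using Suc.hyps(2) A fin by simp
    show "p \<alpha> = b' \<alpha> + (\<Sum>\<beta>\<in>A'. scale (C' \<alpha> \<beta>) (p \<beta>))" if "\<alpha> \<in> A'" for \<alpha>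
      by (rule p'[OF that])
    show "b' \<alpha> \<in> N" if "\<alpha> \<in> A'" for \<alpha>
      unfolding b'_def using that A z bN V.subspace_add[OF N] V.subspace_scale[OF N] by auto
    show "0 \<le> val (C' \<alpha> \<beta>)" if "\<alpha> \<in> A'" "\<beta> \<in> A'" for \<alpha> \<beta>
      unfolding C'_def
      using that A Cnn q by (auto intro!: val_add_nonneg val_mult_nonneg)
    show "0 < val (C' \<alpha> \<beta>)" if "\<alpha> \<in> A'" "\<beta> \<in> A'" "\<not> R \<beta> \<alpha>" for \<alpha> \<beta>
      unfolding C'_def
      using that A Cnn Cpos[of \<alpha> \<beta>] Cpos[of \<alpha> z] max q
      by (auto intro!: val_add_pos val_mult_pos val_mult_nonneg)
  qed (use that A in auto)
  show ?case
  proof (cases "\<alpha> = z")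
    case True
    have "p z \<in> N"
      by (subst pz) (intro V.subspace_add[OF N] V.subspace_scale[OF N] V.subspace_sum[OF N]
          bN z rest; assumption)
    with True show ?thesis by simp
  next
    case False
    with Suc.prems(1) A(1) show ?thesis using rest by blast
  qed
qed


section \<open>Coefficients and multiplication by terms\<close>

lemma mcoeff_add: "mcoeff (f + g) m = mcoeff f m + mcoeff g m"
  by (cases m) (simp add: mcoeff_def lookup_add)

lemma mcoeff_diff: "mcoeff (f - g) m = mcoeff f m - mcoeff (g :: ('k::ab_group_add, _, _) free_mod) m"
  by (cases m) (simp add: mcoeff_def lookup_minus)

lemma mcoeff_0 [simp]: "mcoeff 0 m = 0"
  by (cases m) (simp add: mcoeff_def)

lemma mcoeff_sum: "mcoeff (sum f A) m = (\<Sum>a\<in>A. mcoeff (f a) m)"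
  by (induction A rule: infinite_finite_induct) (auto simp: mcoeff_add)

lemma mcoeff_mterm: "mcoeff (mterm c u k) m = (if m = (u, k) then c else 0)"
  by (cases m) (auto simp: mcoeff_def mterm_def axis_def lookup_single when_def)

lemma free_mod_eqI: "(\<And>m. mcoeff f m = mcoeff g m) \<Longrightarrow> f = g"
  unfolding vec_eq_iff poly_mapping_eq_iff fun_eq_iff mcoeff_def by (metis case_prod_conv)

lemma in_msupp_iff: "m \<in> msupp f \<longleftrightarrow> mcoeff f m \<noteq> 0"
  by (simp add: msupp_def)

lemma finite_msupp: "finite (msupp (f :: ('k::zero, 'n::finite, 'd::finite) free_mod))"
proof -
  have "msupp f \<subseteq> (\<Union>k. (\<lambda>u. (u, k)) ` Poly_Mapping.keys (f $ k))"
    by (force simp: msupp_def mcoeff_def in_keys_iff)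
  then show ?thesis by (rule finite_subset) auto
qed

lemma msupp_empty_iff: "msupp f = {} \<longleftrightarrow> f = 0"
  by (auto simp: in_msupp_iff set_eq_iff intro!: free_mod_eqI)

lemma msupp_0 [simp]: "msupp 0 = {}"
  by (simp add: msupp_empty_iff)

lemma poly_mapping_eq_sum_single:
  "(\<Sum>u\<in>Poly_Mapping.keys h. Poly_Mapping.single u (Poly_Mapping.lookup h u)) = h"
  by (rule poly_mapping_eqI)
    (auto simp: lookup_sum lookup_single when_def in_keys_iff)

lemma lookup_single_mult:
  fixes q :: "'a::cancel_comm_monoid_add \<Rightarrow>\<^sub>0 'k::comm_semiring_1"
  shows "Poly_Mapping.lookup (Poly_Mapping.single a c * q) x = (\<Sum>v\<in>Poly_Mapping.keys q. c * Poly_Mapping.lookup q v when a + v = x)"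
proof -
  have "Poly_Mapping.single a c * q
      = Poly_Mapping.single a c * (\<Sum>v\<in>Poly_Mapping.keys q. Poly_Mapping.single v (Poly_Mapping.lookup q v))"
    by (simp add: poly_mapping_eq_sum_single)
  then show ?thesis by (simp add: sum_distrib_left mult_single lookup_sum lookup_single)
qed

lemma mcoeff_shift:
  fixes f :: "('k::comm_ring_1, 'n::finite, 'd::finite) free_mod"
  shows "mcoeff (Poly_Mapping.single a c *s f) (u + a, k) = c * mcoeff f (u, k)"
proof -
  have "(\<Sum>v\<in>Poly_Mapping.keys (f $ k). c * Poly_Mapping.lookup (f $ k) v when a + v = u + a)
      = (\<Sum>v\<in>Poly_Mapping.keys (f $ k). if v = u then c * Poly_Mapping.lookup (f $ k) v else 0)"
    by (intro sum.cong) (auto simp: when_def add.commute[of a])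
  also have "\<dots> = c * Poly_Mapping.lookup (f $ k) u" by (simp add: in_keys_iff)
  finally show ?thesis by (simp add: mcoeff_def lookup_single_mult)
qed

lemma mcoeff_shift_nonzeroD:
  fixes f :: "('k::comm_ring_1, 'n::finite, 'd::finite) free_mod"
  assumes "mcoeff (Poly_Mapping.single a c *s f) (x, k) \<noteq> 0"
  obtains u where "x = u + a"
proof -
  have "\<exists>v\<in>Poly_Mapping.keys (f $ k). a + v = x"
  proof (rule ccontr)
    assume "\<not> ?thesis"
    then have "(\<Sum>v\<in>Poly_Mapping.keys (f $ k). c * Poly_Mapping.lookup (f $ k) v when a + v = x) = 0"
      by (intro sum.neutral) (auto simp: when_def)
    with assms show False by (simp add: mcoeff_def lookup_single_mult)
  qed
  then show ?thesis using that by (metis add.commute)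
qed

lemma mcoeff_scale:
  fixes f :: "('k::comm_ring_1, 'n::finite, 'd::finite) free_mod"
  shows "mcoeff (Poly_Mapping.single 0 c *s f) m = c * mcoeff f m"
  using mcoeff_shift[of 0 c f "fst m" "snd m"] by simp

lemma msupp_shift:
  fixes f :: "('k::idom, 'n::finite, 'd::finite) free_mod"
  assumes "c \<noteq> 0"
  shows "msupp (Poly_Mapping.single a c *s f) = (\<lambda>(u, k). (u + a, k)) ` msupp f"
proof (intro set_eqI iffI)
  fix m assume "m \<in> msupp (Poly_Mapping.single a c *s f)"
  then have nz: "mcoeff (Poly_Mapping.single a c *s f) (fst m, snd m) \<noteq> 0"
    by (simp add: in_msupp_iff)
  then obtain u where u: "fst m = u + a" by (rule mcoeff_shift_nonzeroD)
  with nz have "(u, snd m) \<in> msupp f" by (auto simp: mcoeff_shift in_msupp_iff)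
  with u show "m \<in> (\<lambda>(u, k). (u + a, k)) ` msupp f" by (force intro: prod_eqI)
qed (use assms in \<open>auto simp: in_msupp_iff mcoeff_shift\<close>)

lemma smult_eq_sum_shifts:
  fixes f :: "('k::comm_ring_1, 'n::finite, 'd::finite) free_mod"
  shows "h *s f = (\<Sum>u\<in>Poly_Mapping.keys h. Poly_Mapping.single u (Poly_Mapping.lookup h u) *s f)"
proof -
  interpret module "(*s) :: _ \<Rightarrow> ('k, 'n, 'd) free_mod \<Rightarrow> _" by (rule module_vec)
  show ?thesis by (simp add: poly_mapping_eq_sum_single flip: scale_sum_left)
qed

lemma vector_space_free_mod:
  "vector_space (\<lambda>c. (*s) (Poly_Mapping.single 0 c) ::
     ('k::field, 'n::finite, 'd::finite) free_mod \<Rightarrow> _)"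
  by unfold_locales
    (auto intro!: free_mod_eqI simp: mcoeff_scale mcoeff_add algebra_simps)

lemma mdeg_add: "mdeg (u + v) = mdeg u + mdeg v"
  by (simp add: mdeg_def sum.distrib)

lemma finite_mdeg_le: "finite {u :: nat ^ 'n::finite. mdeg u \<le> D}"
proof -
  have "{u :: nat ^ 'n. mdeg u \<le> D} \<subseteq> vec_lambda ` (PiE UNIV (\<lambda>_. {..D}))"
  proof
    fix u :: "nat ^ 'n" assume "u \<in> {u. mdeg u \<le> D}"
    then have "u $ i \<le> D" for i
      using member_le_sum[of i UNIV "\<lambda>i. u $ i"] by (simp add: mdeg_def)
    then have "vec_nth u \<in> PiE UNIV (\<lambda>_. {..D})" by auto
    then show "u \<in> vec_lambda ` (PiE UNIV (\<lambda>_. {..D}))" by (metis image_eqI vec_nth_inverse)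
  qed
  then show ?thesis by (rule finite_subset) (intro finite_imageI finite_PiE; simp)
qed

lemma wdot_add: "wdot w (u + v) = wdot w u + wdot w v"
  by (simp add: wdot_def sum.distrib algebra_simps)

text \<open>The multipliers supplied by a division need not be homogeneous. Since each generator is
  homogeneous, the products of degree above \<open>D\<close> in a representation only meet monomials of
  degree above \<open>D\<close>, and \<open>f\<close> has none. They cancel each other and can be dropped, which leaves a sum over an index set
  independent of the multipliers.\<close>
lemma truncated_representation:
  fixes f :: "('k::idom, 'n::finite, 'd::finite) free_mod"
  assumes f: "f = (\<Sum>g\<in>S. h g *s g)" "\<And>u k. (u, k) \<in> msupp f \<Longrightarrow> mdeg u \<le> D"
    and dg: "\<And>g u k. g \<in> S \<Longrightarrow> (u, k) \<in> msupp g \<Longrightarrow> mdeg u = dg g"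
  shows "f = (\<Sum>g\<in>S. \<Sum>b | mdeg b + dg g \<le> D. Poly_Mapping.single b (Poly_Mapping.lookup (h g) b) *s g)"
proof (rule free_mod_eqI)
  let ?c = "\<lambda>g b m. mcoeff (Poly_Mapping.single b (Poly_Mapping.lookup (h g) b) *s g) m"
  fix m :: "(nat ^ 'n) \<times> 'd"
  obtain u k where m: "m = (u, k)" by fastforce
  have deg: "mdeg u = mdeg b + dg g" if g: "g \<in> S" and nz: "?c g b m \<noteq> 0" for g b
  proof -
    have "Poly_Mapping.lookup (h g) b \<noteq> 0" using nz by auto
    then have "m \<in> (\<lambda>(u, k). (u + b, k)) ` msupp g" using nz by (simp add: in_msupp_iff flip: msupp_shift)
    then show ?thesis using dg[OF g] m by (auto simp: mdeg_add)
  qed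
  have fin: "finite {b :: nat ^ 'n. mdeg b + dg g \<le> D}" for g
    by (rule finite_subset[OF _ finite_mdeg_le[of D]]) auto
  show "mcoeff f m = mcoeff (\<Sum>g\<in>S. \<Sum>b | mdeg b + dg g \<le> D.
      Poly_Mapping.single b (Poly_Mapping.lookup (h g) b) *s g) m"
  proof (cases "mdeg u \<le> D")
    case True
    have "(\<Sum>b\<in>Poly_Mapping.keys (h g). ?c g b m) = (\<Sum>b | mdeg b + dg g \<le> D. ?c g b m)"
      if g: "g \<in> S" for g
    proof (rule sum.mono_neutral_cong[OF fin finite_keys])
      show "?c g b m = 0" if "b \<in> {b. mdeg b + dg g \<le> D} - Poly_Mapping.keys (h g)" for b
        using that by (simp add: in_keys_iff)
      show "?c g b m = 0" if "b \<in> Poly_Mapping.keys (h g) - {b. mdeg b + dg g \<le> D}" for b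
        using that deg[OF g, of b] True by auto
    qed simp
    then show ?thesis
      unfolding f(1) by (simp add: mcoeff_sum smult_eq_sum_shifts[of "h _"])
  next
    case False
    then have "mcoeff f m = 0" using f(2) m by (auto simp: in_msupp_iff)
    moreover have "?c g b m = 0" if "g \<in> S" "mdeg b + dg g \<le> D" for g b
      using deg[OF that(1), of b] that(2) False by auto
    ultimately show ?thesis by (simp add: mcoeff_sum)
  qed
qed


section \<open>The term order refined by the valuation\<close>

lemma mon_less_shift:
  assumes "monomial_order prec" "mon_less prec (u, k) (v, l)"
  shows "mon_less prec (u + a, k) (v + a, l)"
  using assms by (auto simp: mon_less_def monomial_order_def)

locale weighted_monomial_order =
  fixes t :: "real \<Rightarrow> 'k::valued_field"
    and w :: "real ^ 'n::finite"
    and prec :: "nat ^ 'n \<Rightarrow> nat ^ 'n \<Rightarrow> bool"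
  assumes splitting: "splitting t"
    and weights: "\<forall>i. w $ i \<in> value_group TYPE('k)"
    and order: "monomial_order prec"
begin

text \<open>The strict order on nonzero terms, read on pairs of a weight and a monomial: a smaller weight
  comes first, and among equal weights the larger monomial comes first. The initial term is thus
  the first term of an element.\<close>
definition precedes ::
  "real \<times> (nat ^ 'n) \<times> 'd::linorder \<Rightarrow> real \<times> (nat ^ 'n) \<times> 'd \<Rightarrow> bool" where
  "precedes = (\<lambda>(\<omega>, m) (\<omega>', m'). \<omega> < \<omega>' \<or> \<omega> = \<omega>' \<and> mon_less prec m' m)"

text \<open>The weight of a monomial in an element; it is meaningful on the support only.\<close>
definition wt :: "('k, 'n, 'd::finite) free_mod \<Rightarrow> (nat ^ 'n) \<times> 'd \<Rightarrow> real" where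
  "wt f m = rval (mcoeff f m) + wdot w (fst m)"

abbreviation key :: "('k, 'n, 'd::finite) free_mod \<Rightarrow> (nat ^ 'n) \<times> 'd \<Rightarrow> real \<times> (nat ^ 'n) \<times> 'd" where
  "key f m \<equiv> (wt f m, m)"

definition is_lead :: "('k, 'n, 'd::{finite,linorder}) free_mod \<Rightarrow> (nat ^ 'n) \<times> 'd \<Rightarrow> bool" where
  "is_lead f m \<longleftrightarrow> m \<in> msupp f \<and> (\<forall>m'\<in>msupp f. m' \<noteq> m \<longrightarrow> precedes (key f m) (key f m'))"

definition lead :: "('k, 'n, 'd::{finite,linorder}) free_mod \<Rightarrow> (nat ^ 'n) \<times> 'd" where
  "lead f = (THE m. is_lead f m)"

definition all_after ::
  "real \<times> (nat ^ 'n) \<times> 'd \<Rightarrow> ('k, 'n, 'd::{finite,linorder}) free_mod \<Rightarrow> bool" where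
  "all_after \<kappa> f \<longleftrightarrow> (\<forall>m\<in>msupp f. precedes \<kappa> (key f m))"

lemma mon_less_irrefl: "\<not> mon_less prec m m"
  using order by (auto simp: mon_less_def monomial_order_def irreflp_def split: prod.splits)

lemma mon_less_trans: "mon_less prec l m \<Longrightarrow> mon_less prec m n \<Longrightarrow> mon_less prec l n"
  using order
  by (auto simp: mon_less_def monomial_order_def split: prod.splits dest: transpD)

lemma mon_less_total: "m \<noteq> n \<Longrightarrow> mon_less prec m n \<or> mon_less prec n m"
  using order
  by (auto simp: mon_less_def monomial_order_def totalp_on_def split: prod.splits)

lemma precedes_irrefl: "\<not> precedes \<kappa> \<kappa>"
  by (cases \<kappa>) (simp add: precedes_def mon_less_irrefl)

lemma precedes_trans: "precedes \<kappa> \<nu> \<Longrightarrow> precedes \<nu> \<mu> \<Longrightarrow> precedes \<kappa> \<mu>"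
  unfolding precedes_def by (auto split: prod.splits dest: mon_less_trans)

lemma precedes_total: "\<kappa> \<noteq> \<nu> \<Longrightarrow> precedes \<kappa> \<nu> \<or> precedes \<nu> \<kappa>"
  using mon_less_total[of "snd \<kappa>" "snd \<nu>"] by (cases \<kappa>; cases \<nu>) (auto simp: precedes_def)

lemma precedes_shift:
  "precedes (\<omega>, (u, k)) (\<omega>', (v, l)) \<Longrightarrow> precedes (\<omega> + c, (u + a, k)) (\<omega>' + c, (v + a, l))"
  unfolding precedes_def using mon_less_shift[OF order] by auto

lemma exists_first_key:
  assumes "finite A" "A \<noteq> {}" "inj_on \<kappa> A"
  shows "\<exists>a\<in>A. \<forall>x\<in>A. x \<noteq> a \<longrightarrow> precedes (\<kappa> a) (\<kappa> x)"
proof (rule Finite_Set.bex_least_element[OF assms(1,2)])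
  show "transp_on A (\<lambda>a x. precedes (\<kappa> a) (\<kappa> x))"
    by (rule transp_onI) (rule precedes_trans)
  show "totalp_on A (\<lambda>a x. precedes (\<kappa> a) (\<kappa> x))"
    by (rule totalp_onI) (use precedes_total assms(3) in \<open>metis inj_onD\<close>)
qed

lemma is_lead_unique:
  assumes "is_lead f m" "is_lead f m'"
  shows "m' = m"
proof (rule ccontr)
  assume "m' \<noteq> m"
  then have "precedes (key f m) (key f m')" "precedes (key f m') (key f m)"
    using assms by (simp_all add: is_lead_def)
  then have "precedes (key f m) (key f m)" by (rule precedes_trans)
  then show False by (simp add: precedes_irrefl)
qed

lemma is_lead_lead:
  assumes "f \<noteq> 0"
  shows "is_lead f (lead f)"
proof -
  have "\<exists>m\<in>msupp f. \<forall>m'\<in>msupp f. m' \<noteq> m \<longrightarrow> precedes (key f m) (key f m')"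
    by (rule exists_first_key) (use assms in \<open>auto simp: finite_msupp msupp_empty_iff inj_on_def\<close>)
  then obtain m where "is_lead f m" by (auto simp: is_lead_def)
  then show ?thesis unfolding lead_def by (rule theI) (rule is_lead_unique[OF \<open>is_lead f m\<close>])
qed

lemma is_lead_nonzero: "is_lead f m \<Longrightarrow> mcoeff f m \<noteq> 0"
  by (simp add: is_lead_def in_msupp_iff)

lemma all_after_iff_lead:
  assumes "is_lead f m"
  shows "all_after \<kappa> f \<longleftrightarrow> precedes \<kappa> (key f m)"
proof
  assume "precedes \<kappa> (key f m)"
  then have "precedes \<kappa> (key f m')" if "m' \<in> msupp f" for m'
    using assms that precedes_trans[of \<kappa> "key f m" "key f m'"]
    by (cases "m' = m") (auto simp: is_lead_def)
  then show "all_after \<kappa> f" by (simp add: all_after_def)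
qed (use assms in \<open>simp add: is_lead_def all_after_def\<close>)

lemma wt_shift:
  assumes "c \<noteq> 0" "(u, k) \<in> msupp f"
  shows "wt (Poly_Mapping.single a c *s f) (u + a, k) = wt f (u, k) + (rval c + wdot w a)"
  using assms by (simp add: wt_def mcoeff_shift rval_mult in_msupp_iff wdot_add)

lemma is_lead_shift:
  assumes c: "c \<noteq> 0" and f: "is_lead f (u, k)"
  shows "is_lead (Poly_Mapping.single a c *s f) (u + a, k)"
  unfolding is_lead_def
proof (intro conjI ballI impI)
  show "(u + a, k) \<in> msupp (Poly_Mapping.single a c *s f)"
    using assms by (auto simp: msupp_shift is_lead_def)
  fix m assume "m \<in> msupp (Poly_Mapping.single a c *s f)" "m \<noteq> (u + a, k)"
  then obtain v l where m: "m = (v + a, l)" "(v, l) \<in> msupp f" "(v, l) \<noteq> (u, k)"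
    using c by (auto simp: msupp_shift)
  have "precedes (key f (u, k)) (key f (v, l))" using f m by (simp add: is_lead_def)
  then show "precedes (key (Poly_Mapping.single a c *s f) (u + a, k))
      (key (Poly_Mapping.single a c *s f) m)"
    using f m c by (simp add: wt_shift is_lead_def precedes_shift)
qed

lemma all_after_shift:
  assumes "c \<noteq> 0" "all_after (\<omega>, (u, k)) f"
  shows "all_after (\<omega> + (rval c + wdot w a), (u + a, k)) (Poly_Mapping.single a c *s f)"
  unfolding all_after_def
proof
  fix m assume "m \<in> msupp (Poly_Mapping.single a c *s f)"
  then obtain v l where m: "m = (v + a, l)" "(v, l) \<in> msupp f"
    using assms(1) by (auto simp: msupp_shift)
  then have "precedes (\<omega>, (u, k)) (key f (v, l))" using assms(2) by (auto simp: all_after_def)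
  then show "precedes (\<omega> + (rval c + wdot w a), (u + a, k)) (key (Poly_Mapping.single a c *s f) m)"
    using m assms(1) by (simp add: wt_shift precedes_shift)
qed

text \<open>The common leading terms cancel, and all the other terms come later. This is what makes an
  S-form start after its two constituents.\<close>
lemma all_after_diff:
  assumes f: "is_lead f m" and g: "is_lead g m" and eq: "mcoeff f m = mcoeff g m"
  shows "all_after (key f m) (f - g)"
  unfolding all_after_def
proof
  fix m' assume "m' \<in> msupp (f - g)"
  then have nz: "mcoeff f m' + - mcoeff g m' \<noteq> 0" by (simp add: in_msupp_iff mcoeff_diff)
  then have "m' \<noteq> m" using eq by auto
  have wteq: "wt f m = wt g m" using eq by (simp add: wt_def)
  have mono: "precedes (key f m) (wt (f - g) m', m')"
    if "precedes (key f m) (\<omega>, m')" "\<omega> \<le> wt (f - g) m'" for \<omega>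
    using that by (auto simp: precedes_def)
  from rval_add_ge[OF nz] show "precedes (key f m) (key (f - g) m')"
  proof
    assume "mcoeff f m' \<noteq> 0 \<and> rval (mcoeff f m') \<le> rval (mcoeff f m' + - mcoeff g m')"
    then show ?thesis using f \<open>m' \<noteq> m\<close>
      by (intro mono[of "wt f m'"]) (auto simp: is_lead_def in_msupp_iff wt_def mcoeff_diff)
  next
    assume "- mcoeff g m' \<noteq> 0 \<and> rval (- mcoeff g m') \<le> rval (mcoeff f m' + - mcoeff g m')"
    then show ?thesis using g \<open>m' \<noteq> m\<close> unfolding wteq
      by (intro mono[of "wt g m'", unfolded wteq])
        (auto simp: is_lead_def in_msupp_iff wt_def mcoeff_diff)
  qed
qed

text \<open>With distinct leading monomials there is no cancellation of leading terms: at the leading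
  monomial of the earliest summand \<open>f z\<close> every other summand has a strictly larger weight, because
  otherwise its own leading term would come before that of \<open>f z\<close>. All other monomials of the sum
  come from terms after the leading one of \<open>f z\<close>.\<close>
lemma lead_sum:
  assumes A: "finite A" "A \<noteq> {}"
    and lead: "\<And>a. a \<in> A \<Longrightarrow> is_lead (f a) (\<mu> a)"
    and inj: "inj_on \<mu> A"
  obtains z where "z \<in> A" "is_lead (sum f A) (\<mu> z)" "wt (sum f A) (\<mu> z) = wt (f z) (\<mu> z)"
    and "\<forall>a\<in>A. a \<noteq> z \<longrightarrow> precedes (key (sum f A) (\<mu> z)) (key (f a) (\<mu> a))"
proof -
  have "inj_on (\<lambda>a. key (f a) (\<mu> a)) A" using inj by (auto simp: inj_on_def)
  from exists_first_key[OF A this] obtain z where z: "z \<in> A"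
    and "\<forall>a\<in>A. a \<noteq> z \<longrightarrow> precedes (key (f z) (\<mu> z)) (key (f a) (\<mu> a))"
    by (rule bexE)
  then have first: "precedes (key (f z) (\<mu> z)) (key (f a) (\<mu> a))" if "a \<in> A" "a \<noteq> z" for a
    using that by simp
  have after: "precedes (key (f z) (\<mu> z)) (key (f a) m)"
    if "a \<in> A" "m \<in> msupp (f a)" "a \<noteq> z \<or> m \<noteq> \<mu> z" for a m
  proof (cases "m = \<mu> a")
    case True
    with that first show ?thesis by auto
  next
    case False
    with that lead have "precedes (key (f a) (\<mu> a)) (key (f a) m)" by (simp add: is_lead_def)
    with that first show ?thesis by (cases "a = z") (auto intro: precedes_trans)
  qed
  let ?rest = "\<Sum>a\<in>A - {z}. mcoeff (f a) (\<mu> z)"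
  have split: "mcoeff (sum f A) (\<mu> z) = mcoeff (f z) (\<mu> z) + ?rest"
    unfolding mcoeff_sum using A(1) z by (rule sum.remove)
  have "mcoeff (sum f A) (\<mu> z) \<noteq> 0 \<and> rval (mcoeff (sum f A) (\<mu> z)) = rval (mcoeff (f z) (\<mu> z))"
    unfolding split
  proof (rule rval_add_dominant)
    show "mcoeff (f z) (\<mu> z) \<noteq> 0" using lead[OF z] by (rule is_lead_nonzero)
    assume "?rest \<noteq> 0"
    then obtain a where a: "a \<in> A" "a \<noteq> z" "mcoeff (f a) (\<mu> z) \<noteq> 0"
      and le: "rval (mcoeff (f a) (\<mu> z)) \<le> rval ?rest"
      using rval_sum_ge_summand[of "A - {z}"] A by blast
    have "precedes (key (f z) (\<mu> z)) (key (f a) (\<mu> z))" using a after by (simp add: in_msupp_iff)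
    then show "rval (mcoeff (f z) (\<mu> z)) < rval ?rest"
      using le by (simp add: precedes_def mon_less_irrefl wt_def)
  qed
  then have nz: "\<mu> z \<in> msupp (sum f A)" and wt: "wt (sum f A) (\<mu> z) = wt (f z) (\<mu> z)"
    by (auto simp: in_msupp_iff wt_def)
  have "precedes (key (sum f A) (\<mu> z)) (key (sum f A) m)"
    if m: "m \<in> msupp (sum f A)" "m \<noteq> \<mu> z" for m
  proof -
    obtain a where a: "a \<in> A" "mcoeff (f a) m \<noteq> 0"
      and le: "rval (mcoeff (f a) m) \<le> rval (mcoeff (sum f A) m)"
      using rval_sum_ge_summand[of A "\<lambda>a. mcoeff (f a) m"] A m
      by (auto simp: in_msupp_iff mcoeff_sum)
    have "precedes (key (f z) (\<mu> z)) (key (f a) m)" using a after m by (simp add: in_msupp_iff)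
    then show ?thesis using le wt by (auto simp: precedes_def wt_def)
  qed
  with nz have "is_lead (sum f A) (\<mu> z)" by (simp add: is_lead_def)
  then show ?thesis by (rule that[OF z _ wt]) (simp add: wt first)
qed

text \<open>A form of the Gauss lemma, transferring a bound on \<open>h *s g\<close> to its constituents. The products of
  the single terms of \<open>h\<close> with \<open>g\<close> have distinct leading monomials, so the earliest of their leading
  terms leads \<open>h *s g\<close>, and the bound holds for it and for all later ones.\<close>
lemma all_after_smultD:
  assumes "is_lead g (u, k)" "all_after \<kappa> (h *s g)" "b \<in> Poly_Mapping.keys h"
  shows "precedes \<kappa> (key (Poly_Mapping.single b (Poly_Mapping.lookup h b) *s g) (u + b, k))"
proof -
  let ?f = "\<lambda>b. Poly_Mapping.single b (Poly_Mapping.lookup h b) *s g"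
  have sum: "h *s g = sum ?f (Poly_Mapping.keys h)" by (rule smult_eq_sum_shifts)
  obtain z where z: "z \<in> Poly_Mapping.keys h" "is_lead (h *s g) (u + z, k)"
    "wt (h *s g) (u + z, k) = wt (?f z) (u + z, k)"
    "\<forall>a\<in>Poly_Mapping.keys h. a \<noteq> z
      \<longrightarrow> precedes (key (h *s g) (u + z, k)) (key (?f a) (u + a, k))"
  proof (rule lead_sum[of "Poly_Mapping.keys h" ?f "\<lambda>b. (u + b, k)"])
    show "is_lead (?f b) (u + b, k)" if "b \<in> Poly_Mapping.keys h" for b
      using that assms(1) by (intro is_lead_shift) (auto simp: in_keys_iff)
  qed (use assms(3) in \<open>auto simp: inj_on_def simp flip: sum\<close>)
  have "precedes \<kappa> (key (h *s g) (u + z, k))"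
    using all_after_iff_lead[OF z(2)] assms(2) by simp
  moreover have "b \<noteq> z \<Longrightarrow> precedes (key (h *s g) (u + z, k)) (key (?f b) (u + b, k))"
    using z(4) assms(3) by simp
  ultimately show ?thesis using z(3) by (cases "b = z") (auto elim: precedes_trans)
qed


section \<open>Initial forms and initial terms through the leading monomial\<close>

lemma rval_in_value_group: "c \<noteq> 0 \<Longrightarrow> rval (c :: 'k) \<in> value_group TYPE('k)"
  using val_eq_rval by (auto simp: value_group_def)

lemma value_group_0: "0 \<in> value_group TYPE('k)"
  using rval_in_value_group[of 1] by simp

lemma value_group_add:
  assumes "\<gamma> \<in> value_group TYPE('k)" "\<delta> \<in> value_group TYPE('k)"
  shows "\<gamma> + \<delta> \<in> value_group TYPE('k)"
proof -
  obtain a b :: 'k where "a \<noteq> 0" "b \<noteq> 0" "val a = ereal \<gamma>" "val b = ereal \<delta>"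
    using assms by (auto simp: value_group_def)
  then have "a * b \<noteq> 0 \<and> val (a * b) = ereal (\<gamma> + \<delta>)" by (simp add: val_mult)
  then show ?thesis unfolding value_group_def by blast
qed

lemma value_group_uminus:
  assumes "\<gamma> \<in> value_group TYPE('k)"
  shows "- \<gamma> \<in> value_group TYPE('k)"
proof -
  obtain a :: 'k where "a \<noteq> 0" "rval a = \<gamma>"
    using assms by (auto simp: value_group_def rval_def)
  then show ?thesis using rval_in_value_group[of "inverse a"] by (simp add: rval_inverse)
qed

lemma value_group_wdot: "wdot w u \<in> value_group TYPE('k)"
proof -
  have "w $ i * real n \<in> value_group TYPE('k)" for i n
    by (induction n) (use weights value_group_0 value_group_add in \<open>auto simp: algebra_simps\<close>)
  then have "(\<Sum>i\<in>X. w $ i * real (u $ i)) \<in> value_group TYPE('k)" for X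
    by (induction X rule: infinite_finite_induct) (auto simp: value_group_0 value_group_add)
  then show ?thesis by (simp add: wdot_def)
qed

lemma value_group_wt: "m \<in> msupp f \<Longrightarrow> wt f m \<in> value_group TYPE('k)"
  by (simp add: wt_def in_msupp_iff value_group_add rval_in_value_group value_group_wdot)

lemma t_nonzero: "\<gamma> \<in> value_group TYPE('k) \<Longrightarrow> t \<gamma> \<noteq> 0"
  using splitting by (simp add: splitting_def)

lemma rval_t: "\<gamma> \<in> value_group TYPE('k) \<Longrightarrow> rval (t \<gamma>) = \<gamma>"
  using splitting by (simp add: splitting_def rval_def)

lemma t_add:
  "\<gamma> \<in> value_group TYPE('k) \<Longrightarrow> \<delta> \<in> value_group TYPE('k) \<Longrightarrow> t (\<gamma> + \<delta>) = t \<gamma> * t \<delta>"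
  using splitting by (simp add: splitting_def)

lemma min_weight_eq:
  assumes "is_lead f m"
  shows "min_weight w f = ereal (wt f m)"
proof -
  have eq: "val (mcoeff f (u, k)) + ereal (wdot w u) = ereal (wt f (u, k))"
    if "(u, k) \<in> msupp f" for u k
    using that by (simp add: wt_def in_msupp_iff val_eq_rval)
  have "(\<lambda>(u, k). val (mcoeff f (u, k)) + ereal (wdot w u)) ` msupp f = (\<lambda>m. ereal (wt f m)) ` msupp f"
    by (rule image_cong) (auto simp: eq)
  moreover have "Min ((\<lambda>m. ereal (wt f m)) ` msupp f) = ereal (wt f m)"
    using assms by (intro Min_eqI) (auto simp: finite_msupp is_lead_def precedes_def)
  ultimately show ?thesis by (simp add: min_weight_def)
qed

text \<open>The coefficients of \<open>t\<^bsup>-\<omega>\<^esup> f(t\<^bsup>w\<^sub>1\<^esup> x\<^sub>1, \<dots>, t\<^bsup>w\<^sub>n\<^esup> x\<^sub>n)\<close>. For \<open>\<omega>\<close> the smallest weight of \<open>f\<close> this element has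
  coefficients in the valuation ring and reduces to the initial form of \<open>f\<close>. Unlike the defining
  formula of the initial form, it is additive in \<open>f\<close> for fixed \<open>\<omega>\<close>.\<close>
definition level_coeff :: "real \<Rightarrow> ('k, 'n, 'd::finite) free_mod \<Rightarrow> (nat ^ 'n) \<times> 'd \<Rightarrow> 'k" where
  "level_coeff \<omega> f m = t (- \<omega>) * mcoeff f m * t (wdot w (fst m))"

lemma level_coeff_0_iff:
  "\<omega> \<in> value_group TYPE('k) \<Longrightarrow> level_coeff \<omega> f m = 0 \<longleftrightarrow> m \<notin> msupp f"
  by (simp add: level_coeff_def in_msupp_iff t_nonzero value_group_uminus value_group_wdot)

lemma rval_level_coeff:
  "\<omega> \<in> value_group TYPE('k) \<Longrightarrow> m \<in> msupp f \<Longrightarrow> rval (level_coeff \<omega> f m) = wt f m - \<omega>"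
  by (simp add: level_coeff_def in_msupp_iff rval_mult rval_t t_nonzero wt_def
      value_group_uminus value_group_wdot)

lemma residue_level_coeff_eq_0_iff:
  assumes "\<omega> \<in> value_group TYPE('k)" "m \<in> msupp f \<Longrightarrow> \<omega> \<le> wt f m"
  shows "0 \<le> val (level_coeff \<omega> f m)"
    and "residue (level_coeff \<omega> f m) = 0 \<longleftrightarrow> (m \<in> msupp f \<longrightarrow> \<omega> < wt f m)"
proof -
  show nn: "0 \<le> val (level_coeff \<omega> f m)"
    using assms by (auto simp: val_nonneg_iff level_coeff_0_iff rval_level_coeff)
  show "residue (level_coeff \<omega> f m) = 0 \<longleftrightarrow> (m \<in> msupp f \<longrightarrow> \<omega> < wt f m)"
    unfolding residue_eq_0_iff[OF nn]
    using assms by (auto simp: val_pos_iff level_coeff_0_iff rval_level_coeff)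
qed

lemma is_lead_wt_le: "is_lead f m \<Longrightarrow> m' \<in> msupp f \<Longrightarrow> wt f m \<le> wt f m'"
  by (cases "m' = m") (auto simp: is_lead_def precedes_def)

lemma mcoeff_init_form:
  assumes f: "is_lead f m"
  shows "mcoeff (init_form t w f) m' = residue (level_coeff (wt f m) f m')"
proof -
  let ?X = "{m'\<in>msupp f. wt f m' = wt f m}"
  have \<omega>: "wt f m \<in> value_group TYPE('k)" using f by (simp add: is_lead_def value_group_wt)
  have X: "{(u, k)\<in>msupp f. val (mcoeff f (u, k)) + ereal (wdot w u) = min_weight w f} = ?X"
    by (auto simp: min_weight_eq[OF f] wt_def in_msupp_iff val_eq_rval)
  have c: "residue (mcoeff f (u, k) * t (- real_of_ereal (val (mcoeff f (u, k)))))
      = residue (level_coeff (wt f m) f (u, k))" if "(u, k) \<in> ?X" for u k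
  proof -
    have "- real_of_ereal (val (mcoeff f (u, k))) = - wt f m + wdot w u"
      using that by (auto simp: wt_def rval_def)
    then have "t (- real_of_ereal (val (mcoeff f (u, k)))) = t (- wt f m) * t (wdot w u)"
      by (simp only: t_add \<omega> value_group_uminus value_group_wdot)
    then show ?thesis by (simp add: level_coeff_def mult_ac)
  qed
  have "init_form t w f = (\<Sum>(u, k)\<in>?X. mterm (residue (level_coeff (wt f m) f (u, k))) u k)"
    unfolding init_form_def X by (rule sum.cong) (auto simp: c)
  then have "mcoeff (init_form t w f) m'
      = (\<Sum>x\<in>?X. if m' = x then residue (level_coeff (wt f m) f x) else 0)"
    by (simp add: mcoeff_sum) (intro sum.cong, auto simp: mcoeff_mterm)
  also have "\<dots> = (if m' \<in> ?X then residue (level_coeff (wt f m) f m') else 0)"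
    by (simp add: finite_msupp)
  also have "\<dots> = residue (level_coeff (wt f m) f m')"
    using residue_level_coeff_eq_0_iff(2)[OF \<omega>, of m' f] is_lead_wt_le[OF f, of m'] by auto
  finally show ?thesis .
qed

lemma msupp_init_form:
  assumes f: "is_lead f m"
  shows "m' \<in> msupp (init_form t w f) \<longleftrightarrow> m' \<in> msupp f \<and> wt f m' = wt f m"
proof -
  have \<omega>: "wt f m \<in> value_group TYPE('k)" using f by (simp add: is_lead_def value_group_wt)
  show ?thesis
    using residue_level_coeff_eq_0_iff(2)[OF \<omega>, of m' f] is_lead_wt_le[OF f, of m']
    by (auto simp: in_msupp_iff mcoeff_init_form[OF f])
qed

lemma mterm_inject: "c \<noteq> 0 \<Longrightarrow> mterm c u k = mterm c' u' k' \<longleftrightarrow> c = c' \<and> u = u' \<and> k = k'"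
  by (metis mcoeff_mterm Pair_inject)

lemma init_term_eq:
  assumes f: "is_lead f (u, k)"
  shows "init_term t w prec f = mterm (mcoeff f (u, k)) u k"
proof -
  let ?in = "msupp (init_form t w f)"
  let ?P = "\<lambda>p. \<exists>u k. (u, k) \<in> ?in \<and> (\<forall>m\<in>?in. m \<noteq> (u, k) \<longrightarrow> mon_less prec m (u, k)) \<and>
      p = mterm (mcoeff f (u, k)) u k"
  have nz: "f \<noteq> 0" using is_lead_nonzero[OF f] by auto
  have "mon_less prec m (u, k)" if "m \<in> ?in" "m \<noteq> (u, k)" for m
    using that f unfolding msupp_init_form[OF f] is_lead_def by (force simp: precedes_def)
  then have top: "\<forall>m\<in>?in. m \<noteq> (u, k) \<longrightarrow> mon_less prec m (u, k)" by simp
  have uk: "(u, k) \<in> ?in" using f by (simp add: msupp_init_form[OF f] is_lead_def)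
  have "(THE p. ?P p) = mterm (mcoeff f (u, k)) u k"
  proof (rule the_equality)
    show "?P (mterm (mcoeff f (u, k)) u k)" using top uk by blast
    show "p = mterm (mcoeff f (u, k)) u k" if "?P p" for p
    proof -
      from that obtain u' k' where u': "(u', k') \<in> ?in"
        "\<forall>m\<in>?in. m \<noteq> (u', k') \<longrightarrow> mon_less prec m (u', k')" "p = mterm (mcoeff f (u', k')) u' k'"
        by blast
      have "(u', k') = (u, k)"
      proof (rule ccontr)
        assume ne: "(u', k') \<noteq> (u, k)"
        have "mon_less prec (u', k') (u, k)" "mon_less prec (u, k) (u', k')"
          using bspec[OF top u'(1)] bspec[OF u'(2) uk] ne ne[symmetric] by (simp_all only: simp_thms)
        then have "mon_less prec (u', k') (u', k')" by (rule mon_less_trans)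
        then show False by (simp add: mon_less_irrefl)
      qed
      with u' show ?thesis by simp
    qed
  qed
  with nz show ?thesis by (simp add: init_term_def)
qed

lemma term_less_mterm_iff:
  assumes "a \<noteq> 0" "b \<noteq> (0::'k)"
  shows "term_less w prec (mterm a u k) (mterm b v l)
    \<longleftrightarrow> precedes (rval a + wdot w u, (u, k)) (rval b + wdot w v, (v, l))"
proof -
  have "mterm b v l \<noteq> 0" using assms(2) mcoeff_mterm[of b v l "(v, l)"] by auto
  then have "term_less w prec (mterm a u k) (mterm b v l) \<longleftrightarrow>
      val a + ereal (wdot w u) < val b + ereal (wdot w v) \<or>
      val a + ereal (wdot w u) = val b + ereal (wdot w v) \<and> mon_less prec (v, l) (u, k)"
    unfolding term_less_def using assms by (auto simp: mterm_inject)
  then show ?thesis using assms by (simp add: precedes_def val_eq_rval)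
qed

text \<open>This turns the inequality between initial terms in the definition of a remainder into a bound on
  all terms. It covers \<open>f = 0\<close>: no nonzero element then has an initial term as large as \<open>0\<close>, so
  \<open>f'\<close> vanishes too.\<close>
lemma all_after_term_ge:
  fixes f f' :: "('k, 'n, 'd::{finite,linorder}) free_mod"
  assumes ge: "term_ge w prec (init_term t w prec f') (init_term t w prec f)"
    and f: "all_after \<kappa> f"
  shows "all_after \<kappa> f'"
proof (cases "f' = 0")
  case True
  then show ?thesis by (simp add: all_after_def in_msupp_iff)
next
  case False
  obtain u k where uk: "lead f' = (u, k)" by fastforce
  have f': "is_lead f' (u, k)" using is_lead_lead[OF False] uk by simp
  have nz: "mcoeff f' (u, k) \<noteq> 0" using f' by (rule is_lead_nonzero)
  show ?thesis
  proof (cases "f = 0")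
    case True
    have "term_less w prec (init_term t w prec f') (init_term t w prec f)"
      unfolding term_less_def init_term_eq[OF f'] using True nz by (auto simp: init_term_def)
    with ge show ?thesis by simp
  next
    case False
    obtain v l where vl: "lead f = (v, l)" by fastforce
    have lf: "is_lead f (v, l)" using is_lead_lead[OF False] vl by simp
    have nz': "mcoeff f (v, l) \<noteq> 0" using lf by (rule is_lead_nonzero)
    have "\<not> precedes (key f' (u, k)) (key f (v, l))"
      using ge unfolding init_term_eq[OF f'] init_term_eq[OF lf] term_less_mterm_iff[OF nz nz']
      by (simp add: wt_def)
    moreover have "precedes \<kappa> (key f (v, l))" using f all_after_iff_lead[OF lf] by simp
    ultimately have "precedes \<kappa> (key f' (u, k))"
      using precedes_total[of "key f' (u, k)" "key f (v, l)"]
      by (cases "key f' (u, k) = key f (v, l)") (auto intro: precedes_trans)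
    then show ?thesis by (simp add: all_after_iff_lead[OF f'])
  qed
qed


lemma init_form_shift:
  fixes g :: "('k, 'n, 'd::{finite,linorder}) free_mod"
  assumes c: "c \<noteq> 0" and g: "is_lead g (u, k)"
  shows "init_form t w (Poly_Mapping.single a c *s g)
    = Poly_Mapping.single a (residue (t (- rval c) * c)) *s init_form t w g"
proof (rule free_mod_eqI)
  let ?f = "Poly_Mapping.single a c *s g" and ?W = "wt g (u, k)"
  fix m :: "(nat ^ 'n) \<times> 'd"
  obtain x l where m: "m = (x, l)" by fastforce
  have uk: "(u, k) \<in> msupp g" using g by (simp add: is_lead_def)
  have f: "is_lead ?f (u + a, k)" using c g by (rule is_lead_shift)
  have W: "?W \<in> value_group TYPE('k)" using uk by (rule value_group_wt)
  have rc: "- rval c \<in> value_group TYPE('k)" using c by (simp add: value_group_uminus rval_in_value_group)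
  have wa: "wdot w a \<in> value_group TYPE('k)" by (rule value_group_wdot)
  show "mcoeff (init_form t w ?f) m
      = mcoeff (Poly_Mapping.single a (residue (t (- rval c) * c)) *s init_form t w g) m"
  proof (cases "\<exists>v. x = v + a")
    case True
    then obtain v where v: "x = v + a" by blast
    have "t 0 * t 0 = t 0"
      using t_add[OF value_group_0 value_group_0] by simp
    then have "t 0 = 1" using t_nonzero[OF value_group_0] by simp
    then have one: "t (- wdot w a) * t (wdot w a) = 1"
      using t_add[OF value_group_uminus[OF wa] wa] by simp
    have "- wt ?f (u + a, k) = - ?W + (- rval c + - wdot w a)"
      using wt_shift[OF c uk, of a] by simp
    then have "t (- wt ?f (u + a, k)) = t (- ?W) * (t (- rval c) * t (- wdot w a))"
      by (simp only: t_add W wa rc value_group_uminus value_group_add)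
    moreover have "t (wdot w (v + a)) = t (wdot w v) * t (wdot w a)"
      by (simp only: wdot_add t_add value_group_wdot)
    ultimately have "level_coeff (wt ?f (u + a, k)) ?f (v + a, l)
        = (t (- wdot w a) * t (wdot w a)) * ((t (- rval c) * c) * level_coeff ?W g (v, l))"
      by (simp add: level_coeff_def mcoeff_shift mult_ac)
    then have "level_coeff (wt ?f (u + a, k)) ?f (v + a, l)
        = (t (- rval c) * c) * level_coeff ?W g (v, l)"
      by (simp add: one)
    moreover have "0 \<le> val (t (- rval c) * c)"
      using c rc by (simp add: val_nonneg_iff rval_mult rval_t t_nonzero)
    moreover have "0 \<le> val (level_coeff ?W g (v, l))"
      using W is_lead_wt_le[OF g] by (rule residue_level_coeff_eq_0_iff)
    ultimately show ?thesis
      using m v by (simp add: mcoeff_init_form[OF f] mcoeff_init_form[OF g] mcoeff_shift residue_mult)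
  next
    case False
    then have "mcoeff (Poly_Mapping.single a d *s h) (x, l) = 0" for d :: "'k" and h
      using mcoeff_shift_nonzeroD[of a d h x l] by blast
    moreover from False have
      "mcoeff (Poly_Mapping.single a d *s h) (x, l) = 0" for d :: "'k residue_field" and h
      using mcoeff_shift_nonzeroD[of a d h x l] by blast
    ultimately show ?thesis
      unfolding m mcoeff_init_form[OF f] by (simp add: level_coeff_def)
  qed
qed

text \<open>By \<open>lead_sum\<close> the weight \<open>\<omega>\<close> of the sum is the smallest weight of a summand. At level \<open>\<omega>\<close>
  reduction is additive; it sends a summand of weight \<open>\<omega>\<close> to its initial form and a summand
  of larger weight to \<open>0\<close>. So \<open>B\<close> consists of the summands of weight \<open>\<omega>\<close>.\<close>
lemma init_form_sum:
  assumes A: "finite A" "A \<noteq> {}"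
    and lead: "\<And>a. a \<in> A \<Longrightarrow> is_lead (f a) (\<mu> a)"
    and inj: "inj_on \<mu> A"
  obtains B where "B \<subseteq> A" "init_form t w (sum f A) = (\<Sum>a\<in>B. init_form t w (f a))"
proof -
  obtain z where z: "z \<in> A" "is_lead (sum f A) (\<mu> z)" "wt (sum f A) (\<mu> z) = wt (f z) (\<mu> z)"
    and after: "\<forall>a\<in>A. a \<noteq> z \<longrightarrow> precedes (key (sum f A) (\<mu> z)) (key (f a) (\<mu> a))"
    by (rule lead_sum[OF A lead inj])
  define \<omega> where "\<omega> = wt (sum f A) (\<mu> z)"
  define B where "B = {a\<in>A. wt (f a) (\<mu> a) = \<omega>}"
  have \<omega>: "\<omega> \<in> value_group TYPE('k)" using z(2) by (simp add: \<omega>_def is_lead_def value_group_wt)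
  have ge: "\<omega> \<le> wt (f a) (\<mu> a)" if "a \<in> A" for a
    using after that z(3) by (cases "a = z") (auto simp: \<omega>_def precedes_def)
  have ge': "\<omega> \<le> wt (f a) m" if "a \<in> A" "m \<in> msupp (f a)" for a m
    using ge[OF that(1)] is_lead_wt_le[OF lead[OF that(1)] that(2)] by simp
  have "init_form t w (sum f A) = (\<Sum>a\<in>B. init_form t w (f a))"
  proof (rule free_mod_eqI)
    fix m
    have single: "residue (level_coeff \<omega> (f a) m)
        = (if a \<in> B then mcoeff (init_form t w (f a)) m else 0)" if a: "a \<in> A" for a
    proof (cases "a \<in> B")
      case True
      then show ?thesis using mcoeff_init_form[OF lead[OF a], of m] by (simp add: B_def)
    next
      case False
      then have "\<omega> < wt (f a) (\<mu> a)" using ge[OF a] a by (simp add: B_def)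
      then have "m \<in> msupp (f a) \<longrightarrow> \<omega> < wt (f a) m"
        using is_lead_wt_le[OF lead[OF a], of m] by auto
      then show ?thesis
        using False residue_level_coeff_eq_0_iff(2)[OF \<omega> ge'[OF a]] by simp
    qed
    have "mcoeff (init_form t w (sum f A)) m = residue (\<Sum>a\<in>A. level_coeff \<omega> (f a) m)"
      using mcoeff_init_form[OF z(2), of m]
      by (simp add: \<omega>_def level_coeff_def mcoeff_sum sum_distrib_left sum_distrib_right)
    also have "\<dots> = (\<Sum>a\<in>A. residue (level_coeff \<omega> (f a) m))"
      using residue_level_coeff_eq_0_iff(1)[OF \<omega> ge'] residue_sum[of A "\<lambda>a. level_coeff \<omega> (f a) m"]
      by blast
    also have "\<dots> = (\<Sum>a\<in>A. if a \<in> B then mcoeff (init_form t w (f a)) m else 0)"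
      using single by (rule sum.cong[OF refl])
    also have "\<dots> = (\<Sum>a\<in>B. mcoeff (init_form t w (f a)) m)"
      using A(1) by (intro sum.mono_neutral_cong_right) (auto simp: B_def)
    finally show "mcoeff (init_form t w (sum f A)) m = mcoeff (\<Sum>a\<in>B. init_form t w (f a)) m"
      by (simp add: mcoeff_sum)
  qed
  then show ?thesis by (rule that[rotated]) (simp add: B_def)
qed


section \<open>S-forms as differences of multiples with the same leading monomial\<close>

lemma term_quot_mterm:
  assumes "b \<noteq> 0" "c \<noteq> (0 :: 'k)"
  shows "term_quot (mterm c (v + a) k) (mterm b v k) = Poly_Mapping.single a (c / b)"
proof -
  have smult: "Poly_Mapping.single x e *s mterm b v k = mterm (e * b) (v + x) k" for x e
    by (simp add: mterm_def vec_eq_iff axis_def mult_single add.commute)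
  show ?thesis
    unfolding term_quot_def
  proof (rule the_equality)
    show "(\<exists>e x. Poly_Mapping.single a (c / b) = Poly_Mapping.single x e) \<and>
        Poly_Mapping.single a (c / b) *s mterm b v k = mterm c (v + a) k"
      using assms by (auto simp: smult)
    fix q assume q: "(\<exists>e x. q = Poly_Mapping.single x e) \<and> q *s mterm b v k = mterm c (v + a) k"
    then obtain e x where ex: "q = Poly_Mapping.single x e" by blast
    with q have "mterm c (v + a) k = mterm (e * b) (v + x) k" by (simp add: smult)
    then have "c = e * b" "v + a = v + x" using assms by (auto simp: mterm_inject)
    then show "q = Poly_Mapping.single a (c / b)" using ex assms by simp
  qed
qed

lemma term_lcm_mterm:
  assumes "b \<noteq> 0" "c \<noteq> (0 :: 'k)"
  shows "term_lcm (mterm b u k) (mterm c v k) = mterm 1 (\<chi> l. max (u $ l) (v $ l)) k"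
proof -
  have "msupp (mterm b u k) = {(u, k)}" "msupp (mterm c v k) = {(v, k)}"
    using assms by (auto simp: in_msupp_iff mcoeff_mterm split: if_splits)
  then show ?thesis by (simp add: term_lcm_def)
qed

text \<open>If two multiples \<open>x\<^sup>a f\<close> and \<open>x\<^sup>b g\<close> have the same leading monomial, it is divisible by the least common
  multiple of those of \<open>f\<close> and \<open>g\<close>, so the difference of the multiples with leading
  coefficients scaled to \<open>1\<close> is a monomial multiple of the S-form. In the S-form itself the leading
  terms \<open>x\<^sup>c e\<^sub>k\<close>, of weight \<open>w \<cdot> c\<close>, cancel.\<close>
lemma S_form_shift:
  fixes f g :: "('k, 'n, 'd::{finite,linorder}) free_mod"
  assumes f: "is_lead f (u, k)" and g: "is_lead g (v, k)" and eq: "u + a = v + b"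
  obtains c s where "u + a = c + s"
    "all_after (wdot w c, (c, k)) (S_form t w prec f g)"
    "Poly_Mapping.single s 1 *s S_form t w prec f g
      = Poly_Mapping.single a (1 / mcoeff f (u, k)) *s f
        - Poly_Mapping.single b (1 / mcoeff g (v, k)) *s g"
proof -
  interpret vec: module "(*s) :: _ \<Rightarrow> ('k, 'n, 'd) free_mod \<Rightarrow> _" by (rule module_vec)
  define c where "c = (\<chi> l. max (u $ l) (v $ l))"
  define a' where "a' = (\<chi> l. c $ l - u $ l)"
  define b' where "b' = (\<chi> l. c $ l - v $ l)"
  define s where "s = (\<chi> l. u $ l + a $ l - c $ l)"
  have pt: "u $ l + a $ l = v $ l + b $ l" for l using eq by (simp add: vec_eq_iff)
  have cu: "c = u + a'" and cv: "c = v + b'" by (auto simp: c_def a'_def b'_def vec_eq_iff)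
  have s: "u + a = c + s"
  proof -
    have "u $ l + a $ l = c $ l + s $ l" for l using pt[of l] by (auto simp: s_def c_def max_def)
    then show ?thesis by (simp add: vec_eq_iff)
  qed
  then have as: "a = s + a'" and bs: "b = s + b'"
    using cu cv eq by (simp_all add: add_ac) (metis add.assoc add.commute add_left_imp_eq)+
  have nf: "mcoeff f (u, k) \<noteq> 0" and ng: "mcoeff g (v, k) \<noteq> 0"
    using is_lead_nonzero[OF f] is_lead_nonzero[OF g] by simp_all
  have "mterm 1 c k \<noteq> (0 :: ('k, 'n, 'd) free_mod)"
    using mcoeff_mterm[of "1::'k" c k "(c, k)"] by auto
  then have S: "S_form t w prec f g
      = Poly_Mapping.single a' (1 / mcoeff f (u, k)) *s f
        - Poly_Mapping.single b' (1 / mcoeff g (v, k)) *s g"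
    using term_quot_mterm[OF nf, of 1 u a' k] term_quot_mterm[OF ng, of 1 v b' k] cu cv
    by (simp add: S_form_def init_term_eq[OF f] init_term_eq[OF g] term_lcm_mterm[OF nf ng]
        Let_def flip: c_def)
  let ?F = "Poly_Mapping.single a' (1 / mcoeff f (u, k)) *s f"
  let ?G = "Poly_Mapping.single b' (1 / mcoeff g (v, k)) *s g"
  have F: "is_lead ?F (c, k)" "mcoeff ?F (c, k) = 1"
    using is_lead_shift[OF _ f, of "1 / mcoeff f (u, k)" a'] nf cu by (simp_all add: mcoeff_shift)
  have G: "is_lead ?G (c, k)" "mcoeff ?G (c, k) = 1"
    using is_lead_shift[OF _ g, of "1 / mcoeff g (v, k)" b'] ng cv by (simp_all add: mcoeff_shift)
  have "all_after (key ?F (c, k)) (?F - ?G)" using F G by (intro all_after_diff) auto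
  then have "all_after (wdot w c, (c, k)) (S_form t w prec f g)"
    using F(2) by (simp add: S wt_def)
  with s show ?thesis
    by (rule that) (simp add: S as bs vec.scale_right_diff_distrib mult_single)
qed


section \<open>Normalized multiples of the generators\<close>

text \<open>Scaling \<open>x\<^sup>b g\<close> by the inverse of \<open>norm_const g b\<close> gives the leading term the coefficient
  \<open>t\<^bsup>- w \<cdot> m\<^esup>\<close>, where \<open>m\<close> is its exponent. So all normalized multiples start at weight \<open>0\<close>, and
  two of them with the same leading monomial have the same leading term.\<close>

definition norm_const :: "('k, 'n, 'd::{finite,linorder}) free_mod \<Rightarrow> nat ^ 'n \<Rightarrow> 'k" where
  "norm_const g b = mcoeff g (lead g) * t (wdot w (fst (lead g) + b))"

definition multiple :: "('k, 'n, 'd::{finite,linorder}) free_mod \<Rightarrow> nat ^ 'n \<Rightarrow> ('k, 'n, 'd) free_mod" where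
  "multiple g b = Poly_Mapping.single b (1 / norm_const g b) *s g"

definition multiple_lead :: "('k, 'n, 'd::{finite,linorder}) free_mod \<Rightarrow> nat ^ 'n \<Rightarrow> (nat ^ 'n) \<times> 'd" where
  "multiple_lead g b = (fst (lead g) + b, snd (lead g))"

lemma norm_const_nonzero: "g \<noteq> 0 \<Longrightarrow> norm_const g b \<noteq> 0"
  using is_lead_nonzero[OF is_lead_lead]
  by (simp add: norm_const_def t_nonzero value_group_wdot)

lemma rval_norm_const:
  assumes "g \<noteq> 0"
  shows "rval (norm_const g b) = wt g (lead g) + wdot w b"
proof -
  have "rval (norm_const g b) = rval (mcoeff g (lead g)) + wdot w (fst (lead g) + b)"
    unfolding norm_const_def using is_lead_nonzero[OF is_lead_lead[OF assms]]
    by (simp add: rval_mult rval_t t_nonzero value_group_wdot)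
  then show ?thesis by (simp add: wt_def wdot_add)
qed

lemma is_lead_term_multiple:
  assumes "g \<noteq> 0" "c \<noteq> 0"
  shows "is_lead (Poly_Mapping.single b c *s g) (multiple_lead g b)"
  using is_lead_shift[OF assms(2), of g "fst (lead g)" "snd (lead g)"] is_lead_lead[OF assms(1)]
  by (simp add: multiple_lead_def)

lemma wt_term_multiple:
  assumes "g \<noteq> 0" "c \<noteq> 0"
  shows "wt (Poly_Mapping.single b c *s g) (multiple_lead g b) = rval (c * norm_const g b)"
  using assms wt_shift[OF assms(2), of "fst (lead g)" "snd (lead g)" g b] is_lead_lead[OF assms(1)]
  by (simp add: multiple_lead_def rval_mult norm_const_nonzero rval_norm_const is_lead_def)

lemma single_eq_scale_multiple:
  fixes g :: "('k, 'n, 'd::{finite,linorder}) free_mod"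
  assumes "g \<noteq> 0"
  shows "Poly_Mapping.single b c *s g
    = Poly_Mapping.single 0 (c * norm_const g b) *s multiple g b"
proof -
  interpret vec: module "(*s) :: _ \<Rightarrow> ('k, 'n, 'd) free_mod \<Rightarrow> _" by (rule module_vec)
  show ?thesis using norm_const_nonzero[OF assms] by (simp add: multiple_def mult_single)
qed

text \<open>The given representation of the S-form, multiplied by a term \<open>d x\<^sup>s\<close>. Its summands are not earlier
  than the S-form, which starts after the least common multiple; multiplying by \<open>d x\<^sup>s\<close> moves this
  bound to the leading term of the two normalized multiples.\<close>
lemma multiple_diff_representation:
  fixes S :: "('k, 'n, 'd::{finite,linorder}) free_mod set"
  assumes g: "g \<noteq> 0" and g': "g' \<noteq> 0"
    and eq: "multiple_lead g b = multiple_lead g' b'"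
    and rem: "is_remainder t w prec S (S_form t w prec g g') 0"
  obtains H where "multiple g b - multiple g' b' = (\<Sum>j\<in>S. H j *s j)"
    and "\<forall>j\<in>S. all_after (0, multiple_lead g b) (H j *s j)"
proof -
  interpret vec: module "(*s) :: _ \<Rightarrow> ('k, 'n, 'd) free_mod \<Rightarrow> _" by (rule module_vec)
  obtain u k where uk: "lead g = (u, k)" by fastforce
  obtain v where v: "lead g' = (v, k)" and ub: "u + b = v + b'"
    using eq uk by (cases "lead g'") (simp add: multiple_lead_def)
  have lg: "is_lead g (u, k)" and lg': "is_lead g' (v, k)"
    using is_lead_lead[OF g] is_lead_lead[OF g'] uk v by simp_all
  from S_form_shift[OF lg lg' ub] obtain c s where cs: "u + b = c + s"
    and after: "all_after (wdot w c, (c, k)) (S_form t w prec g g')"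
    and shift: "Poly_Mapping.single s 1 *s S_form t w prec g g'
      = Poly_Mapping.single b (1 / mcoeff g (u, k)) *s g
        - Poly_Mapping.single b' (1 / mcoeff g' (v, k)) *s g'"
    by blast
  from rem obtain h where h: "S_form t w prec g g' = (\<Sum>j\<in>S. h j *s j)"
    and ge: "\<forall>j\<in>S. term_ge w prec (init_term t w prec (h j *s j))
      (init_term t w prec (S_form t w prec g g'))"
    by (auto simp: is_remainder_def)
  define d where "d = 1 / t (wdot w (u + b))"
  have d: "d \<noteq> 0" "rval d = - wdot w (u + b)"
    by (simp_all add: d_def t_nonzero rval_t value_group_wdot rval_divide)
  define H where "H j = Poly_Mapping.single s d * h j" for j
  have H: "H j *s j = Poly_Mapping.single s d *s (h j *s j)" for j
    by (simp add: H_def)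
  have "Poly_Mapping.single s d *s S_form t w prec g g'
      = Poly_Mapping.single 0 d *s (Poly_Mapping.single s 1 *s S_form t w prec g g')"
    by (simp add: mult_single)
  also have "\<dots> = multiple g b - multiple g' b'"
    unfolding shift
    by (simp add: vec.scale_right_diff_distrib mult_single multiple_def norm_const_def uk v d_def
        ub mult.commute)
  finally have "multiple g b - multiple g' b' = (\<Sum>j\<in>S. H j *s j)"
    by (simp only: H h vec.scale_sum_right)
  moreover have "all_after (0, multiple_lead g b) (H j *s j)" if j: "j \<in> S" for j
  proof -
    have "all_after (wdot w c, (c, k)) (h j *s j)"
      using ge j after all_after_term_ge by blast
    from all_after_shift[OF d(1) this, of s] show ?thesis
      by (simp add: H d(2) cs wdot_add multiple_lead_def uk)
  qed
  ultimately show ?thesis using that by blast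
qed

lemma init_form_multiple_in_span:
  fixes S :: "('k, 'n, 'd::{finite,linorder}) free_mod set"
  assumes "g \<in> S" "g \<noteq> 0" "c \<noteq> 0"
  shows "init_form t w (Poly_Mapping.single b c *s g) \<in> submod_span (init_form t w ` S)"
proof -
  interpret vec: module "(*s) :: _ \<Rightarrow> ('k residue_field, 'n, 'd) free_mod \<Rightarrow> _" by (rule module_vec)
  obtain u k where "lead g = (u, k)" by fastforce
  then have "is_lead g (u, k)" using is_lead_lead[OF assms(2)] by simp
  from init_form_shift[OF assms(3) this, of b] show ?thesis
    using assms(1) by (simp only:) (intro vec.span_scale vec.span_base imageI)
qed

text \<open>The relations between the products of degree at most \<open>D\<close>, read as a linear system in the sense of
  \<open>unipotent_system_solution_in_subspace\<close>: the right-hand sides are the representatives chosen by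
  \<open>sel\<close>, and the unknowns are ordered by their leading monomials.\<close>
lemma multiples_in_span_of_representatives:
  fixes S :: "('k, 'n, 'd::{finite,linorder}) free_mod set" and D :: nat
    and sel :: "(nat ^ 'n) \<times> 'd \<Rightarrow> ('k, 'n, 'd) free_mod \<times> (nat ^ 'n)"
  assumes finS: "finite S" and S0: "0 \<notin> S"
    and dg: "\<And>g u k. g \<in> S \<Longrightarrow> (u, k) \<in> msupp g \<Longrightarrow> mdeg u = dg g"
    and rem: "\<And>f g. f \<in> S \<Longrightarrow> g \<in> S \<Longrightarrow> is_remainder t w prec S (S_form t w prec f g) 0"
    and P: "P = (SIGMA g:S. {b. mdeg b + dg g \<le> D})"
    and sel: "\<And>g b. (g, b) \<in> P \<Longrightarrow> sel (multiple_lead g b) \<in> P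
      \<and> case_prod multiple_lead (sel (multiple_lead g b)) = multiple_lead g b"
    and gb: "(g, b) \<in> P"
  shows "multiple g b \<in> module.span (\<lambda>c. (*s) (Poly_Mapping.single 0 c))
    ((\<lambda>m. case_prod multiple (sel m)) ` case_prod multiple_lead ` P)"
proof -
  define scale where "scale = (\<lambda>c. (*s) (Poly_Mapping.single 0 c) ::
    ('k, 'n, 'd) free_mod \<Rightarrow> ('k, 'n, 'd) free_mod)"
  interpret V: vector_space scale unfolding scale_def by (rule vector_space_free_mod)
  let ?L = "case_prod multiple_lead :: ('k, 'n, 'd) free_mod \<times> (nat ^ 'n) \<Rightarrow> _"
  let ?p = "case_prod multiple :: ('k, 'n, 'd) free_mod \<times> (nat ^ 'n) \<Rightarrow> _"
  let ?N = "V.span ((\<lambda>m. ?p (sel m)) ` ?L ` P)"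
  have finP: "finite P"
    unfolding P by (intro finite_SigmaI finS finite_subset[OF _ finite_mdeg_le[of D]]) auto
  have msupp_multiple: "mdeg u = mdeg b + dg g"
    if "g \<in> S" "(u, k) \<in> msupp (multiple g b)" for g b u k
  proof -
    have "g \<noteq> 0" using that S0 by auto
    then have "(u, k) \<in> (\<lambda>(u, k). (u + b, k)) ` msupp g"
      using that(2) by (simp add: multiple_def msupp_shift norm_const_nonzero)
    then show ?thesis using dg[OF that(1)] by (auto simp: mdeg_add)
  qed
  have rel: "\<exists>C. ?p \<alpha> = ?p (sel (?L \<alpha>)) + (\<Sum>\<beta>\<in>P. scale (C \<beta>) (?p \<beta>)) \<and>
      (\<forall>\<beta>\<in>P. 0 \<le> val (C \<beta>) \<and> (\<not> mon_less prec (?L \<beta>) (?L \<alpha>) \<longrightarrow> 0 < val (C \<beta>)))"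
    if \<alpha>: "\<alpha> \<in> P" for \<alpha>
  proof -
    obtain g b where gb: "\<alpha> = (g, b)" by fastforce
    obtain g' b' where gb': "sel (?L \<alpha>) = (g', b')" by fastforce
    have P': "(g', b') \<in> P" "multiple_lead g b = multiple_lead g' b'"
      using sel[of g b] \<alpha> gb gb' by auto
    have gS: "g \<in> S" "g \<noteq> 0" "g' \<in> S" "g' \<noteq> 0" using \<alpha> gb P' S0 by (auto simp: P)
    obtain H where H: "multiple g b - multiple g' b' = (\<Sum>j\<in>S. H j *s j)"
      and after: "\<forall>j\<in>S. all_after (0, multiple_lead g b) (H j *s j)"
      using multiple_diff_representation[OF gS(2,4) P'(2) rem[OF gS(1,3)]] by blast
    \<comment> \<open>Since \<open>multiple j a\<close> has weight \<open>0\<close>, the valuation of its coefficient is the weight at which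
      the corresponding part of \<open>H j *s j\<close> starts.\<close>
    define C where "C = (\<lambda>(j, a). Poly_Mapping.lookup (H j) a * norm_const j a)"
    have deg: "mdeg u \<le> D" if "(u, k) \<in> msupp (multiple g b - multiple g' b')" for u k
    proof -
      have "(u, k) \<in> msupp (multiple g b) \<or> (u, k) \<in> msupp (multiple g' b')"
        using that by (auto simp: in_msupp_iff mcoeff_diff)
      then show ?thesis using msupp_multiple gS \<alpha> P' gb by (auto simp: P)
    qed
    have "multiple g b - multiple g' b'
        = (\<Sum>j\<in>S. \<Sum>a | mdeg a + dg j \<le> D. Poly_Mapping.single a (Poly_Mapping.lookup (H j) a) *s j)"
      using H deg dg by (rule truncated_representation)
    also have "\<dots> = (\<Sum>j\<in>S. \<Sum>a | mdeg a + dg j \<le> D. scale (C (j, a)) (multiple j a))"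
    proof (intro sum.cong refl)
      fix j a assume "j \<in> S"
      then have "j \<noteq> 0" using S0 by auto
      then show "Poly_Mapping.single a (Poly_Mapping.lookup (H j) a) *s j = scale (C (j, a)) (multiple j a)"
        by (simp only: scale_def C_def prod.case) (rule single_eq_scale_multiple)
    qed
    also have "\<dots> = (\<Sum>\<beta>\<in>P. scale (C \<beta>) (?p \<beta>))"
      unfolding P by (subst sum.Sigma)
        (auto simp: finS split_def intro: finite_subset[OF _ finite_mdeg_le[of D]])
    finally have "?p \<alpha> = ?p (sel (?L \<alpha>)) + (\<Sum>\<beta>\<in>P. scale (C \<beta>) (?p \<beta>))"
      unfolding gb' by (simp add: gb algebra_simps)
    moreover have "0 \<le> val (C \<beta>) \<and> (\<not> mon_less prec (?L \<beta>) (?L \<alpha>) \<longrightarrow> 0 < val (C \<beta>))"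
      if \<beta>: "\<beta> \<in> P" for \<beta>
    proof (cases "C \<beta> = 0")
      case True
      then show ?thesis by simp
    next
      case False
      obtain j a where ja: "\<beta> = (j, a)" by fastforce
      have j: "j \<in> S" "j \<noteq> 0" using \<beta> ja S0 by (auto simp: P)
      have nz: "Poly_Mapping.lookup (H j) a \<noteq> 0" using False ja by (auto simp: C_def)
      obtain v l where vl: "lead j = (v, l)" by fastforce
      have "is_lead j (v, l)" using is_lead_lead[OF j(2)] vl by simp
      from all_after_smultD[OF this bspec[OF after j(1)]]
      have "precedes (0, multiple_lead g b)
          (key (Poly_Mapping.single a (Poly_Mapping.lookup (H j) a) *s j) (multiple_lead j a))"
        using nz vl by (simp add: in_keys_iff multiple_lead_def)
      then have "precedes (0, multiple_lead g b) (rval (C \<beta>), multiple_lead j a)"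
        using wt_term_multiple[OF j(2) nz] by (simp add: ja C_def)
      then show ?thesis by (auto simp: precedes_def gb ja val_nonneg_iff val_pos_iff)
    qed
    ultimately show ?thesis by blast
  qed
  have "\<exists>C. \<forall>\<alpha>\<in>P. ?p \<alpha> = ?p (sel (?L \<alpha>)) + (\<Sum>\<beta>\<in>P. scale (C \<alpha> \<beta>) (?p \<beta>)) \<and>
      (\<forall>\<beta>\<in>P. 0 \<le> val (C \<alpha> \<beta>) \<and> (\<not> mon_less prec (?L \<beta>) (?L \<alpha>) \<longrightarrow> 0 < val (C \<alpha> \<beta>)))"
    by (intro bchoice ballI rel)
  then obtain C where C: "\<forall>\<alpha>\<in>P. ?p \<alpha> = ?p (sel (?L \<alpha>)) + (\<Sum>\<beta>\<in>P. scale (C \<alpha> \<beta>) (?p \<beta>)) \<and>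
      (\<forall>\<beta>\<in>P. 0 \<le> val (C \<alpha> \<beta>) \<and> (\<not> mon_less prec (?L \<beta>) (?L \<alpha>) \<longrightarrow> 0 < val (C \<alpha> \<beta>)))"
    by (rule exE)
  have "?p (g, b) \<in> ?N"
  proof (rule unipotent_system_solution_in_subspace[where scale = scale and A = P and p = ?p
        and b = "\<lambda>\<alpha>. ?p (sel (?L \<alpha>))" and C = C and R = "\<lambda>\<beta> \<alpha>. mon_less prec (?L \<beta>) (?L \<alpha>)"])
    show "vector_space scale" by (rule V.vector_space_axioms)
    show "V.subspace ?N" by (rule V.subspace_span)
    show "irreflp (\<lambda>\<beta> \<alpha>. mon_less prec (?L \<beta>) (?L \<alpha>))"
      by (rule irreflpI) (rule mon_less_irrefl)
    show "transp (\<lambda>\<beta> \<alpha>. mon_less prec (?L \<beta>) (?L \<alpha>))"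
      by (rule transpI) (rule mon_less_trans)
    show "?p (sel (?L \<alpha>)) \<in> ?N" if "\<alpha> \<in> P" for \<alpha>
      using that by (intro V.span_base) blast
    show "?p \<alpha> = ?p (sel (?L \<alpha>)) + (\<Sum>\<beta>\<in>P. scale (C \<alpha> \<beta>) (?p \<beta>))" if "\<alpha> \<in> P" for \<alpha>
      using bspec[OF C that] by (rule conjunct1)
    show "0 \<le> val (C \<alpha> \<beta>)" if "\<alpha> \<in> P" "\<beta> \<in> P" for \<alpha> \<beta>
      using bspec[OF C that(1), THEN conjunct2] that(2) by simp
    show "0 < val (C \<alpha> \<beta>)" if "\<alpha> \<in> P" "\<beta> \<in> P" "\<not> mon_less prec (?L \<beta>) (?L \<alpha>)" for \<alpha> \<beta>
      using bspec[OF C that(1), THEN conjunct2] that(2,3) by simp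
  qed (rule finP, rule gb)
  then show ?thesis by (simp add: scale_def)
qed

text \<open>The degree bound depends on \<open>f\<close>: it is any bound on the degrees of the products in one
  representation of \<open>f\<close>. The span of the representatives then contains \<open>f\<close>, and in a linear combination
  of representatives the leading monomials are distinct, as \<open>init_form_sum\<close> requires.\<close>
lemma init_form_in_span_init_forms:
  fixes S :: "('k, 'n, 'd::{finite,linorder}) free_mod set"
  assumes finS: "finite S" and S0: "0 \<notin> S"
    and hom: "\<And>g. g \<in> S \<Longrightarrow> homogeneous g"
    and rem: "\<And>f g. f \<in> S \<Longrightarrow> g \<in> S \<Longrightarrow> is_remainder t w prec S (S_form t w prec f g) 0"
    and f: "f \<in> submod_span S"
  shows "init_form t w f \<in> submod_span (init_form t w ` S)"
proof -
  interpret M: module "(*s) :: _ \<Rightarrow> ('k, 'n, 'd) free_mod \<Rightarrow> _" by (rule module_vec)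
  interpret I: module "(*s) :: _ \<Rightarrow> ('k residue_field, 'n, 'd) free_mod \<Rightarrow> _" by (rule module_vec)
  define scale where "scale = (\<lambda>c. (*s) (Poly_Mapping.single 0 c) ::
    ('k, 'n, 'd) free_mod \<Rightarrow> ('k, 'n, 'd) free_mod)"
  interpret V: vector_space scale unfolding scale_def by (rule vector_space_free_mod)
  let ?L = "case_prod multiple_lead :: ('k, 'n, 'd) free_mod \<times> (nat ^ 'n) \<Rightarrow> _"
  let ?p = "case_prod multiple :: ('k, 'n, 'd) free_mod \<times> (nat ^ 'n) \<Rightarrow> _"
  from hom have "\<forall>g\<in>S. \<exists>D. \<forall>(u, k)\<in>msupp g. mdeg u = D" by (simp add: homogeneous_def)
  then obtain dg where "\<forall>g\<in>S. \<forall>(u, k)\<in>msupp g. mdeg u = dg g" by metis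
  then have dg: "\<And>g u k. g \<in> S \<Longrightarrow> (u, k) \<in> msupp g \<Longrightarrow> mdeg u = dg g" by blast
  from f obtain h where h: "f = (\<Sum>g\<in>S. h g *s g)" by (auto simp: M.span_finite[OF finS])
  \<comment> \<open>A sum is used as an upper bound of finitely many natural numbers, possibly none.\<close>
  define D where "D = (\<Sum>g\<in>S. \<Sum>b\<in>Poly_Mapping.keys (h g). mdeg b + dg g)"
  have D: "mdeg b + dg g \<le> D" if "g \<in> S" "b \<in> Poly_Mapping.keys (h g)" for g b
  proof -
    have "mdeg b + dg g \<le> (\<Sum>b\<in>Poly_Mapping.keys (h g). mdeg b + dg g)"
      using that(2) by (intro member_le_sum) auto
    also have "\<dots> \<le> D" unfolding D_def using that(1) finS by (intro member_le_sum) auto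
    finally show ?thesis .
  qed
  define P where "P = (SIGMA g:S. {b :: nat ^ 'n. mdeg b + dg g \<le> D})"
  have finP: "finite P"
    unfolding P_def by (intro finite_SigmaI finS finite_subset[OF _ finite_mdeg_le[of D]]) auto
  define sel where "sel m = (SOME \<alpha>. \<alpha> \<in> P \<and> ?L \<alpha> = m)" for m
  have sel: "sel m \<in> P \<and> ?L (sel m) = m" if "m \<in> ?L ` P" for m
    unfolding sel_def by (rule someI_ex) (use that in blast)
  let ?q = "\<lambda>m. ?p (sel m)"
  have q: "is_lead (scale c (?q m)) m \<and> init_form t w (scale c (?q m)) \<in> I.span (init_form t w ` S)"
    if m: "m \<in> ?L ` P" and c: "c \<noteq> 0" for m c
  proof -
    obtain g b where gb: "sel m = (g, b)" by fastforce
    have g: "g \<in> S" "g \<noteq> 0" "multiple_lead g b = m" using sel[OF m] gb S0 by (auto simp: P_def)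
    have nz: "c / norm_const g b \<noteq> 0" using c g norm_const_nonzero by simp
    have "scale c (?q m) = Poly_Mapping.single b (c / norm_const g b) *s g"
      using single_eq_scale_multiple[OF g(2), of b "c / norm_const g b"] norm_const_nonzero[OF g(2)]
      by (simp add: scale_def gb)
    then show ?thesis
      using is_lead_term_multiple[OF g(2) nz, of b] init_form_multiple_in_span[OF g(1,2) nz, of b] g(3)
      by simp
  qed
  have inj: "inj_on ?q (?L ` P)"
  proof (rule inj_onI)
    fix m m' assume m: "m \<in> ?L ` P" "m' \<in> ?L ` P" and eq: "?q m = ?q m'"
    have "is_lead (scale 1 (?q m)) m" "is_lead (scale 1 (?q m)) m'"
      unfolding eq using q[OF m(2), of 1] q[OF m(1), of 1] eq by simp_all
    then show "m = m'" by (rule is_lead_unique[symmetric])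
  qed
  have "multiple g b \<in> V.span (?q ` ?L ` P)" if "(g, b) \<in> P" for g b
    unfolding scale_def
  proof (rule multiples_in_span_of_representatives[OF finS S0 dg rem P_def _ that])
    show "sel (multiple_lead g b) \<in> P \<and> ?L (sel (multiple_lead g b)) = multiple_lead g b"
      if "(g, b) \<in> P" for g b
      using that by (intro sel) force
  qed
  then have "scale c (multiple g b) \<in> V.span (?q ` ?L ` P)" if "(g, b) \<in> P" for g b c
    using that by (intro V.span_scale)
  moreover have "f = (\<Sum>g\<in>S. \<Sum>b\<in>Poly_Mapping.keys (h g).
      scale (Poly_Mapping.lookup (h g) b * norm_const g b) (multiple g b))"
    unfolding h scale_def
    by (rule sum.cong[OF refl], subst smult_eq_sum_shifts, rule sum.cong[OF refl],
        rule single_eq_scale_multiple) (use S0 in auto)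
  ultimately have "f \<in> V.span (?q ` ?L ` P)"
    using D by (auto intro!: V.span_sum simp: P_def)
  then obtain c where "f = (\<Sum>v\<in>?q ` ?L ` P. scale (c v) v)"
    using V.span_finite[of "?q ` ?L ` P"] finP by auto
  then have "f = (\<Sum>m\<in>?L ` P. scale (c (?q m)) (?q m))"
    using inj by (simp add: sum.reindex)
  also have "\<dots> = (\<Sum>m\<in>{m\<in>?L ` P. c (?q m) \<noteq> 0}. scale (c (?q m)) (?q m))"
    using finP by (intro sum.mono_neutral_right) auto
  finally have fsum: "f = (\<Sum>m\<in>{m\<in>?L ` P. c (?q m) \<noteq> 0}. scale (c (?q m)) (?q m))" .
  define A where "A = {m\<in>?L ` P. c (?q m) \<noteq> 0}"
  define F where "F = (\<lambda>m. scale (c (?q m)) (?q m))"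
  have fF: "f = sum F A" unfolding A_def F_def by (rule fsum)
  have F: "is_lead (F m) m" "init_form t w (F m) \<in> I.span (init_form t w ` S)" if "m \<in> A" for m
    using q[of m "c (?q m)"] that unfolding A_def F_def mem_Collect_eq by blast+
  show ?thesis
  proof (cases "A = {}")
    case True
    then have "f = 0" using fF by (simp only: sum.empty)
    then show ?thesis by (simp add: init_form_def I.span_zero)
  next
    case False
    have "finite A" using finP by (simp add: A_def)
    from init_form_sum[OF this False F(1) inj_on_id2] obtain B where
      B: "B \<subseteq> A" "init_form t w f = (\<Sum>m\<in>B. init_form t w (F m))"
      unfolding fF .
    show ?thesis
      unfolding B(2) by (rule I.span_sum) (use B(1) F(2) in blast)
  qed
qed

end

theorem theorem4p4:
  fixes t :: "real \<Rightarrow> 'k::valued_field"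
    and w :: "real ^ 'n"
    and prec :: "nat ^ 'n \<Rightarrow> nat ^ 'n \<Rightarrow> bool"
    and S :: "('k, 'n, 'd::{finite,linorder}) free_mod set"
  assumes "splitting t"
    and "\<forall>i. w $ i \<in> value_group TYPE('k)"
    and "monomial_order prec"
    and "finite S"
    and "\<forall>g\<in>S. g \<noteq> 0 \<and> homogeneous g"
    and "\<forall>f\<in>S. \<forall>g\<in>S. is_remainder t w prec S (S_form t w prec f g) 0"
  shows "groebner_basis t w (submod_span S) S"
proof -
  interpret weighted_monomial_order t w prec by unfold_locales (use assms in simp_all)
  interpret I: module "(*s) :: _ \<Rightarrow> ('k residue_field, 'n, 'd) free_mod \<Rightarrow> _" by (rule module_vec)
  interpret M: module "(*s) :: _ \<Rightarrow> ('k, 'n, 'd) free_mod \<Rightarrow> _" by (rule module_vec)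
  have "init_form t w f \<in> submod_span (init_form t w ` S)" if "f \<in> submod_span S" for f
    by (rule init_form_in_span_init_forms) (use assms that in auto)
  then have "init_submod t w (submod_span S) \<subseteq> submod_span (init_form t w ` S)"
    unfolding init_submod_def by (intro I.span_minimal I.subspace_span) auto
  moreover have "submod_span (init_form t w ` S) \<subseteq> init_submod t w (submod_span S)"
    unfolding init_submod_def by (intro I.span_mono image_mono M.span_superset)
  ultimately show ?thesis using assms(4) by (auto simp: groebner_basis_def)
qed

end
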